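(* Let $\mathcal{C}$ be an analytic curve, let $q\ge 2$, let $M_1,\dots,M_q:\mathcal{C}\to\mathrm{SL}_2(\mathbb{C})$ be analytic maps, and suppose that $[M_r,M_s]\not\equiv 0$ for some fixed choice $r,s\in\{1,\dots,q\}$. Then $M_1,\dots,M_q$ are globally simultaneously unitarizable on $\mathcal{C}$ if and only if the following conditions hold at each $p\in\mathcal{C}$: (i) $M_1,\dots,M_q$ are pointwise simultaneously unitarizable at $p$. (ii) $M_r$ or $M_s$ is locally diagonalizable at $p$. (iii) $M_r$ and $M_s$ are infinitesimally irreducible at $p$. In this case, any simultaneous unitarizer $V$ is unique up to left multiplication by an analytic map $\mathcal{C}\to\mathrm{SU}_2$.
   Context: An analytic curve is a connected real analytic one-dimensional manifold without boundary; "analytic" means real analytic. $[A,B]=AB-BA$. Maps $M_1,\dots,M_q:\mathcal{C}\to\mathrm{SL}_2(\mathbb{C})$ are (globally) simultaneously unitarizable on $\mathcal{C}$ if there is an analytic $V:\mathcal{C}\to\mathrm{SL}_2(\mathbb{C})$ (a simultaneous unitarizer) such that every $VM_kV^{-1}$ takes values in $\mathrm{SU}_2$. They are pointwise simultaneously unitarizable at $p$ if there is a matrix $V\in\mathrm{SL}_2(\mathbb{C})$ with $VM_k(p)V^{-1}\in\mathrm{SU}_2$ for all $k$. An analytic map $M:\mathcal{C}\to\mathrm{SL}_2(\mathbb{C})$ is locally diagonalizable at $p$ if there are a neighborhood $\mathcal{U}$ of $p$ and an analytic map $V:\mathcal{U}\to\mathrm{SL}_2(\mathbb{C})$ such that $VMV^{-1}$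 is diagonal. Analytic maps $A,B:\mathcal{C}\to\mathrm{SL}_2(\mathbb{C})$ are infinitesimally irreducible at $p\in\mathcal{C}$ if $[A,B]\not\equiv 0$ and the (matrix) coefficient of the leading order term in the series expansion of $[A,B]$ at $p$, in a local coordinate, has full rank. *)

theory Defs
  imports "HOL-Analysis.Analysis"
begin

definition has_real_power_series ::
    "(real \<Rightarrow> 'b::real_normed_vector) \<Rightarrow> (nat \<Rightarrow> 'b) \<Rightarrow> real \<Rightarrow> bool"
  where "has_real_power_series f a t \<longleftrightarrow>
    (\<exists>r>0. \<forall>x. \<bar>x - t\<bar> < r \<longrightarrow> (\<lambda>n. (x - t) ^ n *\<^sub>R a n) sums f x)"

definition real_analytic_at :: "(real \<Rightarrow> 'b::real_normed_vector) \<Rightarrow> real \<Rightarrow> bool"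
  where "real_analytic_at f t \<longleftrightarrow> (\<exists>a. has_real_power_series f a t)"

type_synonym 'a chart = "'a set \<times> ('a \<Rightarrow> real)"

text \<open>A chart is a pair \<open>(U, \<phi>)\<close>; the values of \<open>\<phi>\<close> outside \<open>U\<close> are irrelevant, and
  \<open>inv_into U \<phi>\<close> is meaningful only on the open set \<open>\<phi> ` U\<close>.\<close>

definition curve_chart :: "'a topology \<Rightarrow> 'a chart \<Rightarrow> bool"
  where "curve_chart X = (\<lambda>(U, \<phi>). openin X U \<and> open (\<phi> ` U) \<and>
    homeomorphic_map (subtopology X U) (top_of_set (\<phi> ` U)) \<phi>)"

definition analytically_compatible :: "'a chart \<Rightarrow> 'a chart \<Rightarrow> bool"
  where "analytically_compatible = (\<lambda>(U, \<phi>) (W, \<psi>).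
    \<forall>p \<in> U \<inter> W. real_analytic_at (\<psi> \<circ> inv_into U \<phi>) (\<phi> p))"

text \<open>A connected real analytic one-dimensional manifold without boundary, on the point set
  \<open>topspace X\<close>. A manifold is taken to be Hausdorff and second countable. The atlas need not
  be maximal.\<close>

definition analytic_curve :: "'a topology \<Rightarrow> 'a chart set \<Rightarrow> bool"
  where "analytic_curve X \<A> \<longleftrightarrow>
    Hausdorff_space X \<and> second_countable X \<and> connected_space X \<and>
    (\<forall>c \<in> \<A>. curve_chart X c) \<and>
    (\<Union>c \<in> \<A>. fst c) = topspace X \<and>
    (\<forall>c \<in> \<A>. \<forall>d \<in> \<A>. analytically_compatible c d)"

definition analytic_at_point ::
    "'a chart set \<Rightarrow> ('a \<Rightarrow> 'b::real_normed_vector) \<Rightarrow> 'a \<Rightarrow> bool"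
  where "analytic_at_point \<A> f p \<longleftrightarrow>
    (\<forall>(U, \<phi>) \<in> \<A>. p \<in> U \<longrightarrow> real_analytic_at (f \<circ> inv_into U \<phi>) (\<phi> p))"

definition SL2 :: "(complex^2^2) set"
  where "SL2 = {A. det A = 1}"

definition conj_transpose :: "complex^2^2 \<Rightarrow> complex^2^2"
  where "conj_transpose A = map_matrix cnj (transpose A)"

definition SU2 :: "(complex^2^2) set"
  where "SU2 = {A. conj_transpose A ** A = mat 1 \<and> A ** conj_transpose A = mat 1 \<and> det A = 1}"

text \<open>Here \<open>S\<close> is an open subset of the curve and \<open>G\<close> is \<open>SL2\<close> or \<open>SU2\<close>. These are embedded
  real analytic submanifolds of the space of matrices, so a map into \<open>G\<close> is analytic iff it is
  analytic as a matrix-valued map.\<close>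

definition analytic_map_into ::
    "'a chart set \<Rightarrow> 'a set \<Rightarrow> (complex^2^2) set \<Rightarrow> ('a \<Rightarrow> complex^2^2) \<Rightarrow> bool"
  where "analytic_map_into \<A> S G f \<longleftrightarrow> (\<forall>p \<in> S. f p \<in> G \<and> analytic_at_point \<A> f p)"

definition commutator :: "complex^2^2 \<Rightarrow> complex^2^2 \<Rightarrow> complex^2^2"
  where "commutator A B = A ** B - B ** A"

definition simultaneous_unitarizer ::
    "'a topology \<Rightarrow> 'a chart set \<Rightarrow> nat \<Rightarrow> (nat \<Rightarrow> 'a \<Rightarrow> complex^2^2) \<Rightarrow>
     ('a \<Rightarrow> complex^2^2) \<Rightarrow> bool"
  where "simultaneous_unitarizer X \<A> q M V \<longleftrightarrow>
    analytic_map_into \<A> (topspace X) SL2 V \<and>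
    (\<forall>k \<in> {1..q}. \<forall>p \<in> topspace X. V p ** M k p ** matrix_inv (V p) \<in> SU2)"

definition globally_simultaneously_unitarizable ::
    "'a topology \<Rightarrow> 'a chart set \<Rightarrow> nat \<Rightarrow> (nat \<Rightarrow> 'a \<Rightarrow> complex^2^2) \<Rightarrow> bool"
  where "globally_simultaneously_unitarizable X \<A> q M \<longleftrightarrow>
    (\<exists>V. simultaneous_unitarizer X \<A> q M V)"

definition pointwise_simultaneously_unitarizable ::
    "nat \<Rightarrow> (nat \<Rightarrow> 'a \<Rightarrow> complex^2^2) \<Rightarrow> 'a \<Rightarrow> bool"
  where "pointwise_simultaneously_unitarizable q M p \<longleftrightarrow>
    (\<exists>V \<in> SL2. \<forall>k \<in> {1..q}. V ** M k p ** matrix_inv V \<in> SU2)"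

definition is_diagonal :: "complex^2^2 \<Rightarrow> bool"
  where "is_diagonal A \<longleftrightarrow> (\<forall>i j. i \<noteq> j \<longrightarrow> A $ i $ j = 0)"

definition locally_diagonalizable ::
    "'a topology \<Rightarrow> 'a chart set \<Rightarrow> ('a \<Rightarrow> complex^2^2) \<Rightarrow> 'a \<Rightarrow> bool"
  where "locally_diagonalizable X \<A> M p \<longleftrightarrow>
    (\<exists>U V. openin X U \<and> p \<in> U \<and> analytic_map_into \<A> U SL2 V \<and>
      (\<forall>x \<in> U. is_diagonal (V x ** M x ** matrix_inv (V x))))"

text \<open>\<open>a n\<close> is the leading coefficient of the expansion of \<open>[A, B]\<close> in the local coordinate \<open>\<phi>\<close>.
  A change of coordinate multiplies it by a nonzero real number, so the choice of chart does
  not matter.\<close>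

definition infinitesimally_irreducible ::
    "'a topology \<Rightarrow> 'a chart set \<Rightarrow> ('a \<Rightarrow> complex^2^2) \<Rightarrow> ('a \<Rightarrow> complex^2^2) \<Rightarrow> 'a \<Rightarrow> bool"
  where "infinitesimally_irreducible X \<A> A B p \<longleftrightarrow>
    (\<exists>x \<in> topspace X. commutator (A x) (B x) \<noteq> 0) \<and>
    (\<exists>(U, \<phi>) \<in> \<A>. p \<in> U \<and>
      (\<exists>a n. has_real_power_series ((\<lambda>x. commutator (A x) (B x)) \<circ> inv_into U \<phi>) a (\<phi> p) \<and>
        (\<forall>k<n. a k = 0) \<and> a n \<noteq> 0 \<and> rank (a n) = 2))"

end

theory Submission
  imports Defs "HOL-Complex_Analysis.Cauchy_Integral_Formula"
begin

text \<open>For \<open>V\<close> and \<open>M\<close> of determinant one, \<open>V M V\<^sup>-\<^sup>1\<close> is unitary exactly when \<open>M\<close> preserves the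
  positive Hermitian form \<open>V\<^sup>* V\<close>. Conversely a positive form of determinant one has a Cholesky
  factor that depends analytically on it. So a global unitarizer is the same thing as an analytic
  family of positive forms of determinant one preserved by all the \<open>M\<^sub>k\<close>, up to left
  multiplication by \<open>SU\<^sub>2\<close>. Where \<open>M\<^sub>r\<close> and \<open>M\<^sub>s\<close> do not commute, the form is unique
  (\<open>invariant_form_unique\<close>), and by the identity theorem on the connected curve
  (\<open>eventually_nonzero_on_curve\<close>) the other points are isolated. This gives the uniqueness of
  the unitarizer by continuity. It also removes any monodromy from the existence problem: local
  analytic forms agree on overlaps, so it suffices to extend the form that is known pointwise
  off the zeros of the commutator analytically across each zero.

  That extension is \<open>local_invariant_form\<close>. In a local coordinate \<open>x\<close> centred at the point, and
  in an analytic frame in which, say, \<open>M\<^sub>r\<close> is diagonal, the commutator is \<open>x\<^sup>n g\<close> with \<open>g\<close> off-diagonal.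
  The invariant form must be diagonal, with entries \<open>h\<close> and \<open>1/h\<close>, and invariance under \<open>M\<^sub>s\<close>
  forces \<open>h\<^sup>2\<close> to be minus the conjugate of \<open>g\<^sub>2\<^sub>1\<close> divided by \<open>g\<^sub>1\<^sub>2\<close>; the power of \<open>x\<close> cancels.
  Full rank of the leading coefficient says precisely that neither entry of \<open>g\<close> vanishes at the
  point, so \<open>h\<close> extends analytically, and a limit of positive numbers that is not zero is positive.

  For the converse, conjugate by the unitarizer. Special unitary matrices are unit quaternions, so
  the commutator becomes a family of quaternions and so does its leading coefficient; a nonzero
  quaternion is invertible, which is infinitesimal irreducibility. Both \<open>M\<^sub>r\<close> and \<open>M\<^sub>s\<close> are even
  locally diagonalizable, because the traceless part of an analytic quaternionic family is a power
  of \<open>x\<close> times a family with no zero near the point, whose eigenvectors are then analytic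
  (\<open>quaternionic_locally_diagonalizable\<close>).\<close>

section \<open>Real analytic functions of one real variable\<close>

lemma eventually_nhds_abs:
  fixes t :: real
  shows "(\<forall>\<^sub>F x in nhds t. P x) \<longleftrightarrow> (\<exists>d>0. \<forall>x. \<bar>x - t\<bar> < d \<longrightarrow> P x)"
  by (simp add: eventually_nhds_metric dist_real_def)

lemma power_zero_scaleR_sums:
  fixes b :: "nat \<Rightarrow> 'b::real_normed_vector"
  shows "(\<lambda>k. 0 ^ k *\<^sub>R b k) sums b 0"
proof -
  have "(\<lambda>k. 0 ^ k *\<^sub>R b k) sums (\<Sum>k\<in>{0}. 0 ^ k *\<^sub>R b k)"
    by (intro sums_finite) auto
  then show ?thesis by simp
qed

lemma has_real_power_series_cong:
  assumes "has_real_power_series f a t" "\<forall>\<^sub>F x in nhds t. f x = g x"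
  shows "has_real_power_series g a t"
proof -
  obtain r where r: "r > 0" "\<And>x. \<bar>x - t\<bar> < r \<Longrightarrow> (\<lambda>n. (x - t) ^ n *\<^sub>R a n) sums f x"
    using assms(1) unfolding has_real_power_series_def by blast
  obtain d where d: "d > 0" "\<And>x. \<bar>x - t\<bar> < d \<Longrightarrow> f x = g x"
    using assms(2) unfolding eventually_nhds_abs by blast
  have "(\<lambda>n. (x - t) ^ n *\<^sub>R a n) sums g x" if "\<bar>x - t\<bar> < min r d" for x
    using r(2)[of x] d(2)[of x] that by simp
  then show ?thesis
    unfolding has_real_power_series_def using r(1) d(1)
    by (intro exI[of _ "min r d"]) simp
qed

lemma real_analytic_at_cong:
  assumes "\<forall>\<^sub>F x in nhds t. f x = g x"
  shows "real_analytic_at f t \<longleftrightarrow> real_analytic_at g t"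
proof -
  have "\<forall>\<^sub>F x in nhds t. g x = f x"
    using assms by (rule eventually_mono) simp
  with assms show ?thesis
    unfolding real_analytic_at_def using has_real_power_series_cong by blast
qed

lemma real_analytic_at_bounded_linear:
  assumes "bounded_linear T" "real_analytic_at f t"
  shows "real_analytic_at (\<lambda>x. T (f x)) t"
proof -
  interpret T: bounded_linear T by fact
  obtain a r where "r > 0"
    and sums: "\<And>x. \<bar>x - t\<bar> < r \<Longrightarrow> (\<lambda>n. (x - t) ^ n *\<^sub>R a n) sums f x"
    using assms(2) unfolding real_analytic_at_def has_real_power_series_def by blast
  moreover have "(\<lambda>n. (x - t) ^ n *\<^sub>R T (a n)) sums T (f x)" if "\<bar>x - t\<bar> < r" for x
    using T.sums[OF sums[OF that]] by (simp add: T.scaleR)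
  ultimately show ?thesis
    unfolding real_analytic_at_def has_real_power_series_def
    by (intro exI[of _ "\<lambda>n. T (a n)"] exI[of _ r]) auto
qed

lemma real_analytic_at_vec_iff:
  fixes f :: "real \<Rightarrow> 'b::real_normed_vector ^ 'n"
  shows "real_analytic_at f t \<longleftrightarrow> (\<forall>i. real_analytic_at (\<lambda>x. f x $ i) t)"
proof
  assume "real_analytic_at f t"
  then show "\<forall>i. real_analytic_at (\<lambda>x. f x $ i) t"
    using real_analytic_at_bounded_linear[OF bounded_linear_vec_nth] by blast
next
  assume "\<forall>i. real_analytic_at (\<lambda>x. f x $ i) t"
  then obtain a r where ar: "\<And>i. r i > 0"
    "\<And>i x. \<bar>x - t\<bar> < r i \<Longrightarrow> (\<lambda>n. (x - t) ^ n *\<^sub>R a i n) sums (f x $ i)"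
    unfolding real_analytic_at_def has_real_power_series_def by metis
  define R where "R = Min (range r)"
  have "R > 0" unfolding R_def using ar(1) by (subst Min_gr_iff) auto
  moreover have "(\<lambda>n. (x - t) ^ n *\<^sub>R (\<chi> i. a i n)) sums f x" if "\<bar>x - t\<bar> < R" for x
  proof -
    have "\<bar>x - t\<bar> < r i" for i
      using that unfolding R_def by (subst (asm) Min_gr_iff) auto
    then have "(\<lambda>N. sum (\<lambda>n. (x - t) ^ n *\<^sub>R a i n) {..<N}) \<longlonglongrightarrow> (f x $ i)" for i
      using ar(2)[of x i] by (simp add: sums_def)
    then have "(\<lambda>N. sum (\<lambda>n. (x - t) ^ n *\<^sub>R (\<chi> i. a i n)) {..<N} $ i) \<longlonglongrightarrow> (f x $ i)" for i
      by (simp only: sum_component vector_scaleR_component vec_lambda_beta)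
    then show ?thesis
      unfolding sums_def by (rule vec_tendstoI)
  qed
  ultimately show "real_analytic_at f t"
    unfolding real_analytic_at_def has_real_power_series_def
    by (intro exI[of _ "\<lambda>n. \<chi> i. a i n"] exI[of _ R]) simp
qed

text \<open>A power series that converges on a real interval converges on the complex disc over it. This
  reduces the calculus of complex-valued real analytic functions to that of holomorphic ones.\<close>

lemma real_analytic_at_complex_iff:
  fixes f :: "real \<Rightarrow> complex"
  shows "real_analytic_at f t \<longleftrightarrow>
    (\<exists>F. F analytic_on {complex_of_real t} \<and> (\<forall>\<^sub>F x in nhds t. f x = F (complex_of_real x)))"
proof
  assume "real_analytic_at f t"
  then obtain a r where r: "r > 0"
    and sums: "\<And>x. \<bar>x - t\<bar> < r \<Longrightarrow> (\<lambda>n. (x - t) ^ n *\<^sub>R a n) sums f x"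
    unfolding real_analytic_at_def has_real_power_series_def by blast
  define F where "F = (\<lambda>w. \<Sum>n. a n * (w - complex_of_real t) ^ n)"
  have sum': "(\<lambda>n. a n * (complex_of_real x - complex_of_real t) ^ n) sums f x"
    if "\<bar>x - t\<bar> < r" for x
    using sums[OF that] by (simp add: scaleR_conv_of_real mult.commute)
  have "summable (\<lambda>n. a n * (w - complex_of_real t) ^ n)"
    if w: "w \<in> ball (complex_of_real t) r" for w
  proof -
    obtain d where d: "norm (w - complex_of_real t) < d" "d < r"
      using dense[of "norm (w - complex_of_real t)" r] w
      by (auto simp: dist_norm norm_minus_commute)
    then have "d > 0" by (meson le_less_trans norm_ge_zero)
    then have "summable (\<lambda>n. a n * (complex_of_real d) ^ n)"
      using sum'[of "t + d"] d by (auto simp: sums_iff)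
    then show ?thesis
      by (rule powser_inside) (use d(1) \<open>d > 0\<close> in simp)
  qed
  then have "F holomorphic_on ball (complex_of_real t) r"
    unfolding F_def by (intro power_series_holomorphic) (auto simp: summable_sums)
  then have "F analytic_on {complex_of_real t}"
    unfolding analytic_at_ball using r by blast
  moreover have "\<forall>\<^sub>F x in nhds t. f x = F (complex_of_real x)"
    unfolding eventually_nhds_abs F_def using sum' r by (auto simp: sums_iff)
  ultimately show "\<exists>F. F analytic_on {complex_of_real t} \<and>
      (\<forall>\<^sub>F x in nhds t. f x = F (complex_of_real x))" by blast
next
  assume "\<exists>F. F analytic_on {complex_of_real t} \<and>
      (\<forall>\<^sub>F x in nhds t. f x = F (complex_of_real x))"
  then obtain F r where F: "r > 0" "F holomorphic_on ball (complex_of_real t) r"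
    and ev: "\<forall>\<^sub>F x in nhds t. F (complex_of_real x) = f x"
    unfolding analytic_at_ball by (auto elim!: eventually_mono intro: that)
  define a where "a n = (deriv ^^ n) F (complex_of_real t) / fact n" for n
  have "(\<lambda>n. (x - t) ^ n *\<^sub>R a n) sums F (complex_of_real x)" if "\<bar>x - t\<bar> < r" for x
  proof -
    have "complex_of_real x \<in> ball (complex_of_real t) r"
      using that by (simp add: dist_norm abs_minus_commute flip: of_real_diff)
    from holomorphic_power_series[OF F(2) this] show ?thesis
      by (simp add: a_def scaleR_conv_of_real mult.commute)
  qed
  then have "has_real_power_series (\<lambda>x. F (complex_of_real x)) a t"
    unfolding has_real_power_series_def using F(1) by blast
  from has_real_power_series_cong[OF this ev] show "real_analytic_at f t"
    unfolding real_analytic_at_def by blast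
qed

lemma tendsto_of_real_nhds: "filterlim complex_of_real (nhds (complex_of_real t)) (nhds t)"
  by (intro tendsto_intros filterlim_ident)

lemma real_analytic_at_of_complex:
  assumes "F analytic_on {complex_of_real t}"
  shows "real_analytic_at (\<lambda>x. F (complex_of_real x)) t"
  using assms unfolding real_analytic_at_complex_iff by (intro exI[of _ F]) auto

lemma real_analytic_at_complex_binary:
  fixes f g :: "real \<Rightarrow> complex"
  assumes "real_analytic_at f t" "real_analytic_at g t"
    and "\<And>F G. F analytic_on {complex_of_real t} \<Longrightarrow> G analytic_on {complex_of_real t} \<Longrightarrow>
      (\<lambda>z. h (F z) (G z)) analytic_on {complex_of_real t}"
  shows "real_analytic_at (\<lambda>x. h (f x) (g x)) t"
proof -
  obtain F G where "F analytic_on {complex_of_real t}" "\<forall>\<^sub>F x in nhds t. f x = F (complex_of_real x)"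
    "G analytic_on {complex_of_real t}" "\<forall>\<^sub>F x in nhds t. g x = G (complex_of_real x)"
    using assms(1,2) unfolding real_analytic_at_complex_iff by blast
  then show ?thesis
    unfolding real_analytic_at_complex_iff using assms(3)
    by (intro exI[of _ "\<lambda>z. h (F z) (G z)"]) (auto elim: eventually_elim2)
qed

lemma real_analytic_at_const: "real_analytic_at (\<lambda>x. c::complex) t"
  by (intro real_analytic_at_of_complex analytic_intros)

lemma real_analytic_at_cnj:
  "real_analytic_at f t \<Longrightarrow> real_analytic_at (\<lambda>x. cnj (f x)) t"
  by (rule real_analytic_at_bounded_linear[OF bounded_linear_cnj])

lemma real_analytic_at_complex_compose:
  fixes f :: "real \<Rightarrow> complex"
  assumes "real_analytic_at f t" "G analytic_on {f t}"
  shows "real_analytic_at (\<lambda>x. G (f x)) t"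
proof -
  obtain F where F: "F analytic_on {complex_of_real t}"
      and ev: "\<forall>\<^sub>F x in nhds t. f x = F (complex_of_real x)"
    using assms(1) unfolding real_analytic_at_complex_iff by blast
  then have "f t = F (complex_of_real t)"
    using eventually_nhds_x_imp_x by blast
  with F assms(2) have "(G \<circ> F) analytic_on {complex_of_real t}"
    by (intro analytic_on_compose) auto
  then show ?thesis
    unfolding real_analytic_at_complex_iff using ev
    by (intro exI[of _ "G \<circ> F"]) (auto elim: eventually_mono)
qed

lemma real_analytic_at_minus:
  fixes f :: "real \<Rightarrow> complex"
  shows "real_analytic_at f t \<Longrightarrow> real_analytic_at (\<lambda>x. - f x) t"
  by (rule real_analytic_at_bounded_linear[OF bounded_linear_minus[OF bounded_linear_ident]])

lemma real_analytic_at_add: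
  fixes f g :: "real \<Rightarrow> complex"
  shows "real_analytic_at f t \<Longrightarrow> real_analytic_at g t \<Longrightarrow> real_analytic_at (\<lambda>x. f x + g x) t"
  by (erule (1) real_analytic_at_complex_binary) (rule analytic_on_add)

lemma real_analytic_at_diff:
  fixes f g :: "real \<Rightarrow> complex"
  shows "real_analytic_at f t \<Longrightarrow> real_analytic_at g t \<Longrightarrow> real_analytic_at (\<lambda>x. f x - g x) t"
  by (erule (1) real_analytic_at_complex_binary) (rule analytic_on_diff)

lemma real_analytic_at_mult:
  fixes f g :: "real \<Rightarrow> complex"
  shows "real_analytic_at f t \<Longrightarrow> real_analytic_at g t \<Longrightarrow> real_analytic_at (\<lambda>x. f x * g x) t"
  by (erule (1) real_analytic_at_complex_binary) (rule analytic_on_mult)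

lemma real_analytic_at_inverse:
  fixes f :: "real \<Rightarrow> complex"
  shows "real_analytic_at f t \<Longrightarrow> f t \<noteq> 0 \<Longrightarrow> real_analytic_at (\<lambda>x. inverse (f x)) t"
  by (rule real_analytic_at_complex_compose[where G = inverse])
    (auto intro: analytic_on_inverse)

lemma real_analytic_at_divide:
  fixes f g :: "real \<Rightarrow> complex"
  shows "real_analytic_at f t \<Longrightarrow> real_analytic_at g t \<Longrightarrow> g t \<noteq> 0 \<Longrightarrow>
    real_analytic_at (\<lambda>x. f x / g x) t"
  unfolding divide_inverse by (intro real_analytic_at_mult real_analytic_at_inverse)

lemma real_analytic_at_csqrt:
  fixes f :: "real \<Rightarrow> complex"
  shows "real_analytic_at f t \<Longrightarrow> f t \<notin> \<real>\<^sub>\<le>\<^sub>0 \<Longrightarrow> real_analytic_at (\<lambda>x. csqrt (f x)) t"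
  by (erule real_analytic_at_complex_compose) (rule analytic_on_subset[OF analytic_on_csqrt], auto)

lemmas real_analytic_intros = real_analytic_at_const real_analytic_at_cnj real_analytic_at_minus
  real_analytic_at_add real_analytic_at_diff real_analytic_at_mult real_analytic_at_inverse
  real_analytic_at_divide real_analytic_at_csqrt

lemma real_analytic_at_isCont_complex:
  fixes f :: "real \<Rightarrow> complex"
  assumes "real_analytic_at f t"
  shows "isCont f t"
proof -
  obtain F where F: "F analytic_on {complex_of_real t}"
      and ev: "\<forall>\<^sub>F x in nhds t. f x = F (complex_of_real x)"
    using assms unfolding real_analytic_at_complex_iff by blast
  have "isCont (\<lambda>x. F (complex_of_real x)) t"
    using analytic_at_imp_isCont[OF F] by (rule isCont_o2[where f = complex_of_real, rotated]) simp
  with ev show ?thesis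
    by (simp add: isCont_cong)
qed

lemma eventually_real_analytic_at_complex:
  fixes f :: "real \<Rightarrow> complex"
  assumes "real_analytic_at f t"
  shows "\<forall>\<^sub>F x in nhds t. real_analytic_at f x"
proof -
  obtain F where F: "F analytic_on {complex_of_real t}"
      and ev: "\<forall>\<^sub>F x in nhds t. f x = F (complex_of_real x)"
    using assms unfolding real_analytic_at_complex_iff by blast
  obtain S where S: "open S" "complex_of_real t \<in> S" "F holomorphic_on S"
    using F unfolding analytic_at by blast
  then have "\<forall>\<^sub>F z in nhds (complex_of_real t). z \<in> S"
    by (simp add: eventually_nhds_in_open)
  then have "\<forall>\<^sub>F x in nhds t. complex_of_real x \<in> S"
    using tendsto_of_real_nhds by (rule eventually_compose_filterlim)
  moreover have "\<forall>\<^sub>F x in nhds t. \<forall>\<^sub>F y in nhds x. f y = F (complex_of_real y)"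
    using ev by (simp add: eventually_eventually)
  ultimately show ?thesis
  proof eventually_elim
    case (elim x)
    then have "F analytic_on {complex_of_real x}"
      unfolding analytic_at using S by blast
    with elim(2) show ?case
      unfolding real_analytic_at_complex_iff by blast
  qed
qed

lemma real_analytic_at_compose_real:
  fixes f :: "real \<Rightarrow> complex" and \<tau> :: "real \<Rightarrow> real"
  assumes "real_analytic_at \<tau> t" "real_analytic_at f (\<tau> t)"
  shows "real_analytic_at (f \<circ> \<tau>) t" "isCont \<tau> t"
proof -
  have \<tau>: "real_analytic_at (\<lambda>x. complex_of_real (\<tau> x)) t"
    by (rule real_analytic_at_bounded_linear[OF bounded_linear_of_real assms(1)])
  then have "isCont (\<lambda>x. Re (complex_of_real (\<tau> x))) t"
    by (rule isCont_Re[OF real_analytic_at_isCont_complex])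
  then show cont: "isCont \<tau> t" by simp
  obtain F where F: "F analytic_on {complex_of_real (\<tau> t)}"
      and ev: "\<forall>\<^sub>F y in nhds (\<tau> t). f y = F (complex_of_real y)"
    using assms(2) unfolding real_analytic_at_complex_iff by blast
  have "filterlim \<tau> (nhds (\<tau> t)) (nhds t)"
    using cont by (simp add: isCont_def tendsto_at_iff_tendsto_nhds)
  from eventually_compose_filterlim[OF ev this]
  have "\<forall>\<^sub>F x in nhds t. (f \<circ> \<tau>) x = F (complex_of_real (\<tau> x))" by simp
  moreover have "real_analytic_at (\<lambda>x. F (complex_of_real (\<tau> x))) t"
    using real_analytic_at_complex_compose[OF \<tau> F] .
  ultimately show "real_analytic_at (f \<circ> \<tau>) t"
    by (rule real_analytic_at_cong[THEN iffD2])
qed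

text \<open>Dividing out the leading power of the coordinate. Together with
  \<open>has_real_power_series_unshift\<close> this turns statements about the leading coefficient of a series
  into statements about the value \<open>g t\<close> of an analytic function.\<close>

lemma has_real_power_series_shift:
  assumes "has_real_power_series f a t" "\<forall>k<n. a k = 0"
  obtains g where "has_real_power_series g (\<lambda>k. a (k + n)) t" "g t = a n"
    "\<forall>\<^sub>F x in nhds t. f x = (x - t) ^ n *\<^sub>R g x"
proof -
  obtain r where r: "r > 0"
    and sums: "\<And>x. \<bar>x - t\<bar> < r \<Longrightarrow> (\<lambda>k. (x - t) ^ k *\<^sub>R a k) sums f x"
    using assms(1) unfolding has_real_power_series_def by blast
  define g where "g x = (if x = t then a n else inverse ((x - t) ^ n) *\<^sub>R f x)" for x
  have shifted: "(\<lambda>k. (x - t) ^ (k + n) *\<^sub>R a (k + n)) sums f x" if "\<bar>x - t\<bar> < r" for x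
    using sums_split_initial_segment[OF sums[OF that], of n] assms(2) by simp
  have "(\<lambda>k. (x - t) ^ k *\<^sub>R a (k + n)) sums g x" if "\<bar>x - t\<bar> < r" for x
  proof (cases "x = t")
    case True
    then show ?thesis
      using power_zero_scaleR_sums[of "\<lambda>k. a (k + n)"] by (simp add: g_def)
  next
    case False
    from sums_scaleR_right[OF shifted[OF that], of "inverse ((x - t) ^ n)"]
    moreover have "inverse ((x - t) ^ n) * (x - t) ^ (k + n) = (x - t) ^ k" for k
      using False by (simp add: power_add)
    ultimately show ?thesis using False by (simp add: g_def)
  qed
  then have "has_real_power_series g (\<lambda>k. a (k + n)) t"
    unfolding has_real_power_series_def using r by blast
  moreover have "f x = (x - t) ^ n *\<^sub>R g x" if "\<bar>x - t\<bar> < r" for x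
  proof (cases "x = t \<and> n \<noteq> 0")
    case True
    then have "(\<lambda>k. 0) sums f t"
      using shifted[of t] r by (simp add: power_0_left)
    then have "f t = 0"
      using sums_unique2 sums_zero by blast
    then show ?thesis using True by simp
  next
    case False
    show ?thesis
    proof (cases "x = t")
      case True
      with False have "f t = a 0"
        using sums_unique2[OF sums[of t]] power_zero_scaleR_sums[of a] r by simp
      with True False show ?thesis by (simp add: g_def)
    qed (simp add: g_def)
  qed
  then have "\<forall>\<^sub>F x in nhds t. f x = (x - t) ^ n *\<^sub>R g x"
    unfolding eventually_nhds_abs using r by blast
  ultimately show thesis
    using that by (simp add: g_def)
qed

lemma has_real_power_series_at_center:
  assumes "has_real_power_series f a t"
  shows "f t = a 0"
proof -
  obtain g where "g t = a 0" "\<forall>\<^sub>F x in nhds t. f x = (x - t) ^ 0 *\<^sub>R g x"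
    using has_real_power_series_shift[of f a t 0] assms by auto
  then show ?thesis
    using eventually_nhds_x_imp_x by force
qed

lemma has_real_power_series_unshift:
  assumes "has_real_power_series g b t" "\<forall>\<^sub>F x in nhds t. f x = (x - t) ^ n *\<^sub>R g x"
  shows "has_real_power_series f (\<lambda>k. if k < n then 0 else b (k - n)) t"
proof -
  obtain r where r: "r > 0"
    and sums: "\<And>x. \<bar>x - t\<bar> < r \<Longrightarrow> (\<lambda>k. (x - t) ^ k *\<^sub>R b k) sums g x"
    using assms(1) unfolding has_real_power_series_def by blast
  let ?a = "\<lambda>k. if k < n then 0 else b (k - n)"
  have "(\<lambda>k. (x - t) ^ k *\<^sub>R ?a k) sums ((x - t) ^ n *\<^sub>R g x)" if "\<bar>x - t\<bar> < r" for x
  proof -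
    have "(\<lambda>k. (x - t) ^ (k + n) *\<^sub>R ?a (k + n)) sums ((x - t) ^ n *\<^sub>R g x)"
      using sums_scaleR_right[OF sums[OF that], of "(x - t) ^ n"]
      by (simp add: power_add mult.commute)
    moreover have "(\<Sum>k<n. (x - t) ^ k *\<^sub>R ?a k) = 0"
      by (intro sum.neutral) simp
    ultimately show ?thesis
      by (subst sums_iff_shift'[of _ n, symmetric]) simp
  qed
  then have "has_real_power_series (\<lambda>x. (x - t) ^ n *\<^sub>R g x) ?a t"
    unfolding has_real_power_series_def using r by blast
  then show ?thesis
    by (rule has_real_power_series_cong) (use assms(2) in \<open>simp add: eq_commute\<close>)
qed

lemma real_analytic_at_matrix_iff:
  fixes f :: "real \<Rightarrow> 'b::real_normed_vector ^ 'n ^ 'm"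
  shows "real_analytic_at f t \<longleftrightarrow> (\<forall>i j. real_analytic_at (\<lambda>x. f x $ i $ j) t)"
  by (simp add: real_analytic_at_vec_iff[of f] real_analytic_at_vec_iff[of "\<lambda>x. f x $ i" for i])

lemma real_analytic_at_isCont:
  fixes f :: "real \<Rightarrow> complex ^ 'n ^ 'm"
  assumes "real_analytic_at f t"
  shows "isCont f t"
proof -
  have "((\<lambda>x. f x $ i $ j) \<longlongrightarrow> f t $ i $ j) (at t)" for i j
    using assms real_analytic_at_isCont_complex unfolding real_analytic_at_matrix_iff isCont_def
    by blast
  then show ?thesis
    unfolding isCont_def by (auto intro!: vec_tendstoI)
qed

lemma eventually_real_analytic_at:
  fixes f :: "real \<Rightarrow> complex ^ 'n ^ 'm"
  assumes "real_analytic_at f t"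
  shows "\<forall>\<^sub>F x in nhds t. real_analytic_at f x"
  using assms eventually_real_analytic_at_complex unfolding real_analytic_at_matrix_iff
  by (intro eventually_all_finite) blast

lemma real_analytic_at_compose:
  fixes f :: "real \<Rightarrow> complex ^ 'n ^ 'm" and \<tau> :: "real \<Rightarrow> real"
  assumes "real_analytic_at \<tau> t" "real_analytic_at f (\<tau> t)"
  shows "real_analytic_at (f \<circ> \<tau>) t"
  using assms real_analytic_at_compose_real(1)[of \<tau> t "\<lambda>x. f x $ i $ j" for i j]
  unfolding real_analytic_at_matrix_iff o_def by blast

lemma real_analytic_at_matrix_mult:
  fixes f :: "real \<Rightarrow> complex^2^2" and g :: "real \<Rightarrow> complex^2^2"
  assumes "real_analytic_at f t" "real_analytic_at g t"
  shows "real_analytic_at (\<lambda>x. f x ** g x) t"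
  using assms unfolding real_analytic_at_matrix_iff matrix_matrix_mult_def sum_2
  by (auto intro!: real_analytic_intros)

lemma real_analytic_at_commutator:
  fixes f :: "real \<Rightarrow> complex^2^2" and g :: "real \<Rightarrow> complex^2^2"
  assumes "real_analytic_at f t" "real_analytic_at g t"
  shows "real_analytic_at (\<lambda>x. commutator (f x) (g x)) t"
  using assms real_analytic_at_matrix_mult[of f t g] real_analytic_at_matrix_mult[of g t f]
  unfolding real_analytic_at_matrix_iff commutator_def
  by (auto intro!: real_analytic_intros)

lemma real_analytic_at_conj_transpose:
  assumes "real_analytic_at f t"
  shows "real_analytic_at (\<lambda>x. conj_transpose (f x)) t"
  using assms unfolding real_analytic_at_matrix_iff conj_transpose_def map_matrix_def transpose_def
  by (auto intro!: real_analytic_intros)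

text \<open>The identity theorem for germs, in the form of a leading term: a function that is not
  locally zero is a power of the coordinate times a function that does not vanish at the centre,
  hence nowhere near it.\<close>

lemma real_analytic_at_leading_term:
  fixes f :: "real \<Rightarrow> complex ^ 'n ^ 'm"
  assumes "real_analytic_at f t"
  shows "(\<forall>\<^sub>F x in nhds t. f x = 0) \<or>
    (\<exists>n g. real_analytic_at g t \<and> g t \<noteq> 0 \<and> (\<forall>\<^sub>F x in nhds t. f x = (x - t) ^ n *\<^sub>R g x))"
proof -
  obtain a where a: "has_real_power_series f a t"
    using assms unfolding real_analytic_at_def by blast
  show ?thesis
  proof (cases "\<forall>n. a n = 0")
    case True
    obtain r where "r > 0" "\<And>x. \<bar>x - t\<bar> < r \<Longrightarrow> (\<lambda>k. 0) sums f x"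
      using a True unfolding has_real_power_series_def by auto
    then have "\<forall>\<^sub>F x in nhds t. f x = 0"
      unfolding eventually_nhds_abs using sums_unique2 sums_zero by blast
    then show ?thesis by blast
  next
    case False
    define n where "n = (LEAST n. a n \<noteq> 0)"
    have n: "a n \<noteq> 0" "\<forall>k<n. a k = 0"
      using False LeastI_ex[of "\<lambda>n. a n \<noteq> 0"] unfolding n_def by (blast dest: not_less_Least)+
    obtain g where "has_real_power_series g (\<lambda>k. a (k + n)) t" "g t = a n"
      "\<forall>\<^sub>F x in nhds t. f x = (x - t) ^ n *\<^sub>R g x"
      using has_real_power_series_shift[OF a n(2)] .
    then have "real_analytic_at g t \<and> g t \<noteq> 0 \<and> (\<forall>\<^sub>F x in nhds t. f x = (x - t) ^ n *\<^sub>R g x)"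
      unfolding real_analytic_at_def using n(1) by auto
    then show ?thesis by blast
  qed
qed

lemma eventually_at_nonzero_of_leading_term:
  fixes g :: "real \<Rightarrow> complex ^ 'n ^ 'm"
  assumes "real_analytic_at g t" "g t \<noteq> 0" "\<forall>\<^sub>F x in nhds t. f x = (x - t) ^ n *\<^sub>R g x"
  shows "\<forall>\<^sub>F x in at t. f x \<noteq> 0"
proof -
  have "\<forall>\<^sub>F x in at t. g x \<noteq> 0"
    using real_analytic_at_isCont[OF assms(1)] assms(2)
    by (simp add: isCont_def tendsto_imp_eventually_ne)
  moreover have "\<forall>\<^sub>F x in at t. f x = (x - t) ^ n *\<^sub>R g x"
    using assms(3) by (simp add: eventually_nhds_conv_at)
  moreover have "\<forall>\<^sub>F x in at t. x \<noteq> t"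
    by (simp add: eventually_at_filter)
  ultimately show ?thesis
    by eventually_elim simp
qed

lemma real_analytic_at_eventually_zero_or_nonzero:
  fixes f :: "real \<Rightarrow> complex ^ 'n ^ 'm"
  assumes "real_analytic_at f t"
  shows "(\<forall>\<^sub>F x in nhds t. f x = 0) \<or> (\<forall>\<^sub>F x in at t. f x \<noteq> 0)"
  using real_analytic_at_leading_term[OF assms] eventually_at_nonzero_of_leading_term by blast

section \<open>Two by two complex matrices\<close>

text \<open>With matrices written by their entries, matrix identities become identities between complex
  numbers.\<close>

definition mat2 :: "complex \<Rightarrow> complex \<Rightarrow> complex \<Rightarrow> complex \<Rightarrow> complex^2^2"
  where "mat2 a b c d = vector [vector [a, b], vector [c, d]]"

lemma mat2_nth [simp]:
  "mat2 a b c d $ 1 $ 1 = a" "mat2 a b c d $ 1 $ 2 = b"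
  "mat2 a b c d $ 2 $ 1 = c" "mat2 a b c d $ 2 $ 2 = d"
  by (simp_all add: mat2_def)

lemma mat2_eq_iff [simp]: "mat2 a b c d = mat2 a' b' c' d' \<longleftrightarrow> a = a' \<and> b = b' \<and> c = c' \<and> d = d'"
  by (auto simp: vec_eq_iff forall_2)

lemma mat2_eta: "A = mat2 (A$1$1) (A$1$2) (A$2$1) (A$2$2)"
  by (simp add: vec_eq_iff forall_2)

lemma mat2_cases: obtains a b c d where "A = mat2 a b c d"
  using mat2_eta by blast

lemma mat2_arith [simp]:
  "mat2 a b c d ** mat2 a' b' c' d' =
    mat2 (a*a' + b*c') (a*b' + b*d') (c*a' + d*c') (c*b' + d*d')"
  "mat2 a b c d - mat2 a' b' c' d' = mat2 (a - a') (b - b') (c - c') (d - d')"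
  "x *\<^sub>R mat2 a b c d = mat2 (x *\<^sub>R a) (x *\<^sub>R b) (x *\<^sub>R c) (x *\<^sub>R d)"
  "conj_transpose (mat2 a b c d) = mat2 (cnj a) (cnj c) (cnj b) (cnj d)"
  "det (mat2 a b c d) = a * d - b * c"
  by (simp_all add: vec_eq_iff forall_2 matrix_matrix_mult_def sum_2 conj_transpose_def
      map_matrix_def transpose_def det_2)

lemma mat_1_mat2: "mat 1 = mat2 1 0 0 1" and zero_mat2: "0 = mat2 0 0 0 0"
  by (simp_all add: vec_eq_iff forall_2 mat_def)

lemma matrix_inv_unique:
  fixes A B :: "'b::semiring_1^'n^'n"
  assumes "A ** B = mat 1" "B ** A = mat 1"
  shows "matrix_inv A = B"
proof -
  have "A ** matrix_inv A = mat 1 \<and> matrix_inv A ** A = mat 1"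
    unfolding matrix_inv_def by (rule someI[of _ B]) (use assms in simp)
  then show ?thesis
    using assms by (metis matrix_mul_assoc matrix_mul_lid matrix_mul_rid)
qed

lemma matrix_inv_mat2:
  assumes "a * d - b * c = 1"
  shows "matrix_inv (mat2 a b c d) = mat2 d (- b) (- c) a"
proof (rule matrix_inv_unique)
qed (use assms in \<open>simp_all add: mat_1_mat2 algebra_simps\<close>)

lemma rank_eq_2_iff_det: "rank (A :: complex^2^2) = 2 \<longleftrightarrow> det A \<noteq> 0"
proof -
  have "rank A = 2 \<longleftrightarrow> vec.span (rows A) = UNIV"
    unfolding row_rank_def_gen
    using vec.dim_eq_full[of "rows A"] vec_dim_card[where 'a = complex and 'n = 2]
    by (simp add: vec.dim_UNIV vec.dimension_def)
  also have "\<dots> \<longleftrightarrow> det A \<noteq> 0"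
    by (metis invertible_det_nz invertible_left_inverse matrix_left_invertible_span_rows_gen)
  finally show ?thesis .
qed

lemma SL2_inverse:
  assumes "V \<in> SL2"
  shows "V ** matrix_inv V = mat 1" "matrix_inv V ** V = mat 1" "matrix_inv V \<in> SL2"
  using assms by (cases V rule: mat2_cases; simp add: SL2_def matrix_inv_mat2 mat_1_mat2 algebra_simps)+

lemma SL2_cancel:
  assumes "V \<in> SL2"
  shows "A ** V ** matrix_inv V = A" "A ** matrix_inv V ** V = A"
  using SL2_inverse(1,2)[OF assms] by (simp_all flip: matrix_mul_assoc)

lemma SL2_mult: "V \<in> SL2 \<Longrightarrow> W \<in> SL2 \<Longrightarrow> V ** W \<in> SL2"
  by (simp add: SL2_def det_mul)

lemma det_conjugate: "V \<in> SL2 \<Longrightarrow> det (V ** A ** matrix_inv V) = det A"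
  using SL2_inverse(3)[of V] by (simp add: SL2_def det_mul)

lemma conjugate_conjugate:
  assumes "V \<in> SL2" "W \<in> SL2"
  shows "W ** (V ** A ** matrix_inv V) ** matrix_inv W = (W ** V) ** A ** matrix_inv (W ** V)"
proof -
  have "matrix_inv (W ** V) = matrix_inv V ** matrix_inv W"
    using assms by (intro matrix_inv_unique) (simp_all add: matrix_mul_assoc SL2_cancel SL2_inverse)
  then show ?thesis by (simp add: matrix_mul_assoc)
qed

lemma commutator_conjugate:
  assumes "V \<in> SL2"
  shows "commutator (V ** A ** matrix_inv V) (V ** B ** matrix_inv V) =
    V ** commutator A B ** matrix_inv V"
proof -
  have *: "(V ** A ** matrix_inv V) ** (V ** B ** matrix_inv V) = V ** (A ** B) ** matrix_inv V"
    for A B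
    using assms by (simp add: matrix_mul_assoc SL2_cancel)
  have "C ** (A - B) ** D = C ** A ** D - C ** B ** D" for A B C D :: "complex^2^2"
    by (cases A rule: mat2_cases; cases B rule: mat2_cases;
        cases C rule: mat2_cases; cases D rule: mat2_cases) (simp add: algebra_simps)
  then show ?thesis
    unfolding commutator_def * by simp
qed

lemma conjugate_scaleR: "V ** (x *\<^sub>R A) ** W = x *\<^sub>R (V ** A ** W)" for A V W :: "complex^2^2"
  by (cases V rule: mat2_cases; cases A rule: mat2_cases; cases W rule: mat2_cases)
    (simp add: scaleR_add_right algebra_simps)

lemma conjugate_eq_0_iff:
  assumes "V \<in> SL2"
  shows "V ** A ** matrix_inv V = 0 \<longleftrightarrow> A = 0"
proof
  assume "V ** A ** matrix_inv V = 0"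
  then have "matrix_inv V ** (V ** A ** matrix_inv V) ** V = 0"
    by simp
  moreover have "matrix_inv V ** (V ** A ** matrix_inv V) ** V = A"
    using assms by (simp add: matrix_mul_assoc SL2_cancel SL2_inverse)
  ultimately show "A = 0" by simp
qed simp

text \<open>The real algebra spanned by the special unitary matrices is the algebra of quaternions,
  whose norm form is the determinant; it is therefore a division algebra.\<close>

definition quaternionic :: "complex^2^2 \<Rightarrow> bool"
  where "quaternionic Y \<longleftrightarrow> Y$2$2 = cnj (Y$1$1) \<and> Y$1$2 = - cnj (Y$2$1)"

lemma SU2_iff: "A \<in> SU2 \<longleftrightarrow> quaternionic A \<and> det A = 1"
proof -
  obtain a b c d where 1: "A = mat2 a b c d" by (rule mat2_cases)
  show ?thesis
  proof
    assume "A \<in> SU2"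
    then have 2: "cnj a * a + cnj c * c = 1" "cnj a * b + cnj c * d = 0" "a * d - b * c = 1"
      using 1 by (auto simp: SU2_def mat_1_mat2)
    have "d = cnj a" "b = - cnj c"
      using 2 by algebra+
    then show "quaternionic A \<and> det A = 1"
      using 1 2 by (simp add: quaternionic_def)
  next
    assume "quaternionic A \<and> det A = 1"
    then show "A \<in> SU2"
      using 1 by (auto simp: quaternionic_def SU2_def mat_1_mat2 algebra_simps)
  qed
qed

lemma quaternionic_mult: "quaternionic A \<Longrightarrow> quaternionic B \<Longrightarrow> quaternionic (A ** B)"
  by (cases A rule: mat2_cases; cases B rule: mat2_cases) (simp add: quaternionic_def)

lemma quaternionic_diff: "quaternionic A \<Longrightarrow> quaternionic B \<Longrightarrow> quaternionic (A - B)"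
  by (simp add: quaternionic_def)

lemma quaternionic_scaleR: "quaternionic A \<Longrightarrow> quaternionic (x *\<^sub>R A)"
  by (simp add: quaternionic_def)

lemma quaternionic_commutator:
  "quaternionic A \<Longrightarrow> quaternionic B \<Longrightarrow> quaternionic (commutator A B)"
  by (simp add: commutator_def quaternionic_mult quaternionic_diff)

lemma quaternionic_det:
  assumes "quaternionic Y"
  shows "det Y = of_real ((cmod (Y$1$1))\<^sup>2 + (cmod (Y$2$1))\<^sup>2)"
  using assms by (cases Y rule: mat2_cases) (simp add: quaternionic_def complex_norm_square flip: of_real_power; simp add: algebra_simps)

lemma quaternionic_det_eq_0_iff:
  assumes "quaternionic Y"
  shows "det Y = 0 \<longleftrightarrow> Y = 0"
proof
  assume "det Y = 0"
  then have "(cmod (Y$1$1))\<^sup>2 + (cmod (Y$2$1))\<^sup>2 = 0"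
    using quaternionic_det[OF assms] by (metis of_real_eq_0_iff)
  then have "Y$1$1 = 0" "Y$2$1 = 0"
    by (simp_all add: sum_power2_eq_zero_iff)
  then show "Y = 0"
    using assms by (simp add: quaternionic_def vec_eq_iff forall_2)
qed (simp add: zero_mat2)

section \<open>Invariant Hermitian forms\<close>

text \<open>A Hermitian matrix of determinant one is definite, and the sign of its first diagonal entry
  tells whether it is positive.\<close>

definition positive_form :: "complex^2^2 \<Rightarrow> bool"
  where "positive_form H \<longleftrightarrow> conj_transpose H = H \<and> Re (H$1$1) > 0 \<and> det H = 1"

definition pullback :: "complex^2^2 \<Rightarrow> complex^2^2 \<Rightarrow> complex^2^2"
  where "pullback V H = conj_transpose V ** H ** V"

lemma conj_transpose_mult: "conj_transpose (A ** B) = conj_transpose B ** conj_transpose A"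
  by (cases A rule: mat2_cases; cases B rule: mat2_cases) (simp add: mult.commute)

lemma conj_transpose_conj_transpose: "conj_transpose (conj_transpose A) = A"
  by (cases A rule: mat2_cases) simp

lemma det_conj_transpose: "det (conj_transpose A) = cnj (det A)"
  by (cases A rule: mat2_cases) simp

lemma pullback_mult: "pullback (A ** B) H = pullback B (pullback A H)"
  by (simp add: pullback_def conj_transpose_mult matrix_mul_assoc)

lemma pullback_mat_1 [simp]: "pullback (mat 1) H = H"
  by (cases H rule: mat2_cases) (simp add: pullback_def mat_1_mat2)

lemma pullback_inverse:
  assumes "V \<in> SL2"
  shows "pullback V (pullback (matrix_inv V) H) = H" "pullback (matrix_inv V) (pullback V H) = H"
  using SL2_inverse[OF assms] by (simp_all flip: pullback_mult)

lemma unitary_iff_pullback: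
  assumes "U \<in> SL2"
  shows "U \<in> SU2 \<longleftrightarrow> pullback U (mat 1) = mat 1"
  using assms matrix_left_right_inverse[of U "conj_transpose U"]
  by (auto simp: SU2_def SL2_def pullback_def)

text \<open>Whether \<open>V\<close> unitarizes \<open>M\<close> depends on \<open>V\<close> only through the form \<open>V\<^sup>* V\<close>. This is what makes
  the problem one about invariant forms, which are unique where unitarizers are not.\<close>

lemma conjugate_in_SU2_iff:
  assumes "V \<in> SL2" "M \<in> SL2"
  shows "V ** M ** matrix_inv V \<in> SU2 \<longleftrightarrow> pullback M (pullback V (mat 1)) = pullback V (mat 1)"
proof -
  have "V ** M ** matrix_inv V \<in> SL2"
    using assms SL2_inverse(3) SL2_mult by blast
  then have "V ** M ** matrix_inv V \<in> SU2 \<longleftrightarrow>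
      pullback (matrix_inv V) (pullback M (pullback V (mat 1))) = mat 1"
    by (simp add: unitary_iff_pullback pullback_mult)
  also have "\<dots> \<longleftrightarrow> pullback M (pullback V (mat 1)) = pullback V (mat 1)"
    by (metis pullback_inverse[OF assms(1)])
  finally show ?thesis .
qed

lemma invariant_pullback_iff:
  assumes "V \<in> SL2"
  shows "pullback M (pullback V H) = pullback V H \<longleftrightarrow> pullback (V ** M ** matrix_inv V) H = H"
  by (metis pullback_inverse[OF assms] pullback_mult)

lemma positive_form_mat2:
  "positive_form (mat2 h k k' l) \<longleftrightarrow>
    h \<in> \<real> \<and> l \<in> \<real> \<and> k' = cnj k \<and> Re h > 0 \<and> h * l - k * k' = 1"
  by (auto simp: positive_form_def complex_is_Real_iff complex_eq_iff)

lemma positive_form_pullback: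
  assumes "V \<in> SL2" "positive_form H"
  shows "positive_form (pullback V H)"
proof -
  obtain h k k' l where H: "H = mat2 h k k' l" by (rule mat2_cases)
  obtain a b c d where V: "V = mat2 a b c d" by (rule mat2_cases)
  have H': "h \<in> \<real>" "l \<in> \<real>" "k' = cnj k" "Re h > 0" "h * l - k * k' = 1"
    using assms(2) unfolding H positive_form_mat2 by auto
  have "conj_transpose (pullback V H) = pullback V H"
    using assms(2) by (simp add: pullback_def conj_transpose_mult conj_transpose_conj_transpose
          positive_form_def matrix_mul_assoc)
  moreover have "det (pullback V H) = 1"
    using assms by (simp add: SL2_def pullback_def det_mul det_conj_transpose positive_form_def)
  moreover have "Re (pullback V H $ 1 $ 1) > 0"
  proof -
    let ?v = "pullback V H $ 1 $ 1"
    \<comment> \<open>completing the square in the quadratic form, evaluated on the first column of \<open>V\<close>\<close>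
    have "h * ?v = cnj (h * a + k * c) * (h * a + k * c) + cnj c * c"
    proof -
      have "cnj h = h" using H'(1) by (simp add: Reals_cnj_iff)
      moreover have "h * l = 1 + k * cnj k" using H'(3,5) by (simp add: algebra_simps)
      moreover have "h * ?v = cnj a * h * h * a + h * cnj c * cnj k * a + h * cnj a * k * c +
          (h * l) * cnj c * c"
        using H'(3) by (simp add: V H pullback_def algebra_simps)
      ultimately show ?thesis
        by (simp add: algebra_simps)
    qed
    then have "Re (h * ?v) = (cmod (h * a + k * c))\<^sup>2 + (cmod c)\<^sup>2"
      by (metis Re_complex_of_real complex_norm_square mult.commute of_real_add)
    moreover have "(cmod (h * a + k * c))\<^sup>2 + (cmod c)\<^sup>2 > 0"
    proof (rule ccontr)
      assume "\<not> ?thesis"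
      then have "(cmod (h * a + k * c))\<^sup>2 + (cmod c)\<^sup>2 = 0"
        using sum_power2_ge_zero[of "cmod (h * a + k * c)" "cmod c"] by linarith
      then have "h * a + k * c = 0 \<and> c = 0"
        unfolding sum_power2_eq_zero_iff norm_eq_zero .
      moreover have "h \<noteq> 0" using H'(4) by auto
      ultimately show False
        using assms(1) by (auto simp: V SL2_def)
    qed
    moreover have "Re (h * ?v) = Re h * Re ?v"
      using H'(1) by (simp add: complex_is_Real_iff)
    ultimately show ?thesis
      using H'(4) by (metis zero_less_mult_pos)
  qed
  ultimately show ?thesis by (simp add: positive_form_def)
qed

lemma positive_form_mat_1: "positive_form (mat 1)"
  by (simp add: mat_1_mat2 positive_form_mat2)

text \<open>The Cholesky factor rather than the positive square root: its entries are explicit analytic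
  functions of the entries of \<open>H\<close>.\<close>

definition cholesky :: "complex^2^2 \<Rightarrow> complex^2^2"
  where "cholesky H =
    mat2 (csqrt (H$1$1)) (H$1$2 / csqrt (H$1$1)) 0 (inverse (csqrt (H$1$1)))"

lemma cholesky:
  assumes "positive_form H"
  shows "cholesky H \<in> SL2" "pullback (cholesky H) (mat 1) = H"
proof -
  obtain h k k' l where H: "H = mat2 h k k' l" by (rule mat2_cases)
  have H': "h \<in> \<real>" "l \<in> \<real>" "k' = cnj k" "Re h > 0" "h * l - k * k' = 1"
    using assms unfolding H positive_form_mat2 by auto
  define r where "r = csqrt h"
  have "h = of_real (Re h)" using H'(1) by (simp add: of_real_Re)
  then have r: "r = of_real (sqrt (Re h))"
    unfolding r_def using H'(4) by (metis csqrt_of_real_nonneg less_imp_le Re_complex_of_real Im_complex_of_real of_real_sqrt)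
  have "r * r = h"
    unfolding r_def using power2_csqrt[of h] by (simp add: power2_eq_square)
  moreover have "cnj r = r" "r \<noteq> 0"
    using H'(4) unfolding r by simp_all
  ultimately have rr: "r * r = h" "cnj r = r" "r \<noteq> 0" .
  have [simp]: "h \<noteq> 0" using H'(4) by auto
  show "cholesky H \<in> SL2"
    using rr by (simp add: cholesky_def H SL2_def flip: r_def)
  have "h * l = k * cnj k + 1"
    using H'(3,5) by (simp add: algebra_simps)
  then have "cnj k * k / (r * r) + 1 / (r * r) = l"
    unfolding rr(1) by (simp add: field_simps)
  then have "cnj (k / r) * (k / r) + cnj (inverse r) * inverse r = l"
    using rr(2) by (simp add: field_simps)
  moreover have "cnj r * (k / r) = k" "cnj (k / r) * r = k'" "cnj r * r = h"
    using rr H'(3) by simp_all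
  ultimately show "pullback (cholesky H) (mat 1) = H"
    by (simp add: cholesky_def H pullback_def mat_1_mat2 flip: r_def)
qed

text \<open>The matrices commuting with a nonscalar two by two matrix \<open>N\<close> are the polynomials in \<open>N\<close>, and
  these commute with each other. In coordinates: modulo scalars a matrix is a vector in
  three-dimensional space, the commutator is a multiple of the cross product, and two vectors that are both
  parallel to a nonzero vector have cross product zero.\<close>

lemma commutant_scalar:
  assumes "N ** A = A ** N" "N ** B = B ** N" "commutator A B \<noteq> 0"
  shows "N$1$2 = 0" "N$2$1 = 0" "N$1$1 = N$2$2"
proof -
  obtain n1 n2 n3 n4 where N: "N = mat2 n1 n2 n3 n4" by (rule mat2_cases)
  obtain a b c d where A: "A = mat2 a b c d" by (rule mat2_cases)
  obtain a' b' c' d' where B: "B = mat2 a' b' c' d'" by (rule mat2_cases)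
  define x x' m where "x = a - d" and "x' = a' - d'" and "m = n1 - n4"
  note defs = x_def x'_def m_def
  have raw: "n1 * a + n2 * c = a * n1 + b * n3" "n1 * b + n2 * d = a * n2 + b * n4"
      "n3 * a + n4 * c = c * n1 + d * n3"
    and raw': "n1 * a' + n2 * c' = a' * n1 + b' * n3" "n1 * b' + n2 * d' = a' * n2 + b' * n4"
      "n3 * a' + n4 * c' = c' * n1 + d' * n3"
    using assms(1,2) unfolding N A B mat2_arith mat2_eq_iff by blast+
  have e: "n2 * c = b * n3" "m * b = x * n2" "m * c = x * n3"
    and e': "n2 * c' = b' * n3" "m * b' = x' * n2" "m * c' = x' * n3"
    unfolding defs using raw raw' by algebra+
  have "commutator A B = mat2 (b * c' - b' * c) (x * b' - x' * b) (x' * c - x * c') (b' * c - b * c')"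
    by (simp add: A B commutator_def defs algebra_simps)
  then have C: "b * c' - b' * c \<noteq> 0 \<or> x * b' - x' * b \<noteq> 0 \<or> x' * c - x * c' \<noteq> 0"
    using assms(3) by (auto simp: zero_mat2)
  have 1: "n2 * (b * c' - b' * c) = 0" "m * (x * b' - x' * b) = 0" "m * (x' * c - x * c') = 0"
    and 2: "n2 * (x' * c - x * c') = n3 * (x' * b - x * b')"
      "m * (b * c' - b' * c) = n2 * (x * c' - x' * c)"
  proof -
    have "n2 * (b * c' - b' * c) = b * (n2 * c') - b' * (n2 * c)"
      "m * (x * b' - x' * b) = x * (m * b') - x' * (m * b)"
      "m * (x' * c - x * c') = x' * (m * c) - x * (m * c')"
      "n2 * (x' * c - x * c') = x' * (n2 * c) - x * (n2 * c')"
      "m * (b * c' - b' * c) = c' * (m * b) - c * (m * b')"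
      by (simp_all add: algebra_simps)
    then show "n2 * (b * c' - b' * c) = 0" "m * (x * b' - x' * b) = 0" "m * (x' * c - x * c') = 0"
      "n2 * (x' * c - x * c') = n3 * (x' * b - x * b')"
      "m * (b * c' - b' * c) = n2 * (x * c' - x' * c)"
      unfolding e e' by (simp_all add: algebra_simps)
  qed
  have 6: "n3 * (b * c' - b' * c) = 0" "n2 * (x * b' - x' * b) = 0" "n3 * (x' * c - x * c') = 0"
    and 7: "n3 * (x * b' - x' * b) = n2 * (x * c' - x' * c)"
  proof -
    have "n3 * (b * c' - b' * c) = c' * (b * n3) - c * (b' * n3)"
      "n2 * (x * b' - x' * b) = b' * (x * n2) - b * (x' * n2)"
      "n3 * (x' * c - x * c') = c * (x' * n3) - c' * (x * n3)"
      "n3 * (x * b' - x' * b) = x * (b' * n3) - x' * (b * n3)"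
      by (simp_all add: algebra_simps)
    then show "n3 * (b * c' - b' * c) = 0" "n2 * (x * b' - x' * b) = 0" "n3 * (x' * c - x * c') = 0"
      "n3 * (x * b' - x' * b) = n2 * (x * c' - x' * c)"
      unfolding e[symmetric] e'[symmetric] by (simp_all add: algebra_simps)
  qed
  \<comment> \<open>the remaining product occurs with both signs\<close>
  have "m * (b * c' - b' * c) = b * (m * c') - b' * (m * c)"
    by (simp add: algebra_simps)
  also have "\<dots> = n3 * (x' * b - x * b')"
    unfolding e e' by (simp add: algebra_simps)
  also have "\<dots> = n2 * (x' * c - x * c')"
    using 2(1) by simp
  also have "\<dots> = - (m * (b * c' - b' * c))"
    unfolding 2(2) by (simp add: algebra_simps)
  finally have 3: "m * (b * c' - b' * c) = 0" by simp
  have 4: "n2 * (x' * c - x * c') = 0"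
    using 3 unfolding 2(2) by (auto simp: algebra_simps)
  have 5: "n3 * (x * b' - x' * b) = 0"
    using 4 unfolding 7 by (auto simp: algebra_simps)
  have "n2 = 0" "n3 = 0" "m = 0"
    using C 1 3 4 5 6 by auto
  then show "N$1$2 = 0" "N$2$1 = 0" "N$1$1 = N$2$2"
    by (simp_all add: N m_def)
qed

text \<open>Schur's lemma in elementary form: if \<open>H\<close> and \<open>K\<close> are invariant under \<open>A\<close> and \<open>B\<close>, then
  \<open>H\<^sup>-\<^sup>1 K\<close> commutes with both, so it is a scalar. The determinants make that scalar a sign, and
  positivity excludes \<open>- 1\<close>.\<close>

lemma invariant_form_unique:
  assumes H: "positive_form H" "pullback A H = H" "pullback B H = H"
    and K: "positive_form K" "pullback A K = K" "pullback B K = K"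
    and "A \<in> SL2" "B \<in> SL2" "commutator A B \<noteq> 0"
  shows "H = K"
proof -
  have inv: "H \<in> SL2" "K \<in> SL2" using H(1) K(1) by (simp_all add: positive_form_def SL2_def)
  define N where "N = matrix_inv H ** K"
  have comm: "N ** M = M ** N" if M: "M \<in> SL2" "pullback M H = H" "pullback M K = K" for M
  proof -
    have "H ** (N ** M) = K ** M"
      using SL2_inverse(1)[OF inv(1)] by (simp add: N_def matrix_mul_assoc)
    moreover have "H ** (M ** N) = K ** M"
    proof -
      have "conj_transpose M ** (H ** M) ** N = conj_transpose M ** (K ** M)"
        using M(2,3) SL2_inverse(1)[OF inv(1)] unfolding pullback_def N_def
        by (simp add: matrix_mul_assoc)
      then have "matrix_inv (conj_transpose M) ** (conj_transpose M ** (H ** M) ** N) =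
          matrix_inv (conj_transpose M) ** (conj_transpose M ** (K ** M))"
        by simp
      moreover have "matrix_inv (conj_transpose M) ** conj_transpose M = mat 1"
      proof (rule SL2_inverse)
        show "conj_transpose M \<in> SL2"
          using M(1) by (simp add: SL2_def det_conj_transpose)
      qed
      ultimately show ?thesis
        by (simp add: matrix_mul_assoc)
    qed
    ultimately have "matrix_inv H ** (H ** (N ** M)) = matrix_inv H ** (H ** (M ** N))"
      by simp
    then show ?thesis
      using SL2_inverse(2)[OF inv(1)] by (simp add: matrix_mul_assoc)
  qed
  have sc: "N$1$2 = 0" "N$2$1 = 0" "N$1$1 = N$2$2"
    using commutant_scalar[OF comm comm] assms by blast+
  have K_eq: "K = H ** N"
    using SL2_inverse(1)[OF inv(1)] by (simp add: N_def matrix_mul_assoc)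
  define n where "n = N$1$1"
  have N: "N = mat2 n 0 0 n"
    using sc by (subst mat2_eta) (simp add: n_def)
  have "det N = 1"
    using inv K_eq by (simp add: SL2_def det_mul)
  then have "n * n = 1" by (simp add: N)
  then have "n = 1 \<or> n = - 1" by (simp add: square_eq_1_iff)
  moreover have "n \<noteq> - 1"
  proof
    assume "n = - 1"
    then have "K$1$1 = - H$1$1"
      unfolding K_eq by (cases H rule: mat2_cases) (simp add: N)
    then show False using H(1) K(1) by (simp add: positive_form_def)
  qed
  ultimately have "N = mat 1" by (simp add: N mat_1_mat2)
  then show ?thesis using K_eq by simp
qed

text \<open>Invariance under \<open>A\<close> multiplies the off-diagonal entry of \<open>H\<close> by the square of an eigenvalue
  of \<open>A\<close>. That square is not one because the two eigenvalues are distinct and mutually inverse, so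
  \<open>H\<close> is diagonal, and invariance under \<open>B\<close> then fixes the ratio of its entries.\<close>

lemma invariant_form_of_diagonal:
  assumes H: "positive_form H" "pullback A H = H" "pullback B H = H"
    and "A \<in> SL2" "B \<in> SL2" "is_diagonal A" "commutator A B \<noteq> 0"
  obtains h where "h > 0" "H = mat2 (of_real h) 0 0 (inverse (of_real h))"
    "commutator A B $ 1 $ 2 \<noteq> 0"
    "(of_real h)\<^sup>2 = - cnj (commutator A B $ 2 $ 1) / commutator A B $ 1 $ 2"
proof -
  obtain h k k' l where H_eq: "H = mat2 h k k' l" by (rule mat2_cases)
  obtain p p2 p3 q where "A = mat2 p p2 p3 q" by (rule mat2_cases)
  with assms(6) have A: "A = mat2 p 0 0 q"
    unfolding is_diagonal_def by (metis mat2_nth(2,3) num1_eq1 one_neq_zero zero_neq_one)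
  obtain a b c d where B: "B = mat2 a b c d" by (rule mat2_cases)
  have H': "h \<in> \<real>" "l \<in> \<real>" "k' = cnj k" "Re h > 0" "h * l - k * k' = 1"
    using H(1) unfolding H_eq positive_form_mat2 by auto
  have h0: "h \<noteq> 0" using H'(4) by auto
  have pq: "p * q = 1" and detB: "a * d - b * c = 1" using assms(4,5) by (simp_all add: A B SL2_def)
  have C: "commutator A B = mat2 0 ((p - q) * b) (- (p - q) * c) 0"
    by (simp add: A B commutator_def algebra_simps)
  have ne: "p \<noteq> q" using assms(7) by (auto simp: C zero_mat2)
  have inv: "cnj p * h * p = h" "cnj p * k * q = k"
    using H(2) by (simp_all add: A H_eq pullback_def)
  have "cnj p * p = 1" using inv(1) h0 by (simp add: mult.assoc mult.left_commute)
  then have q: "q = cnj p" using pq by algebra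
  have "k = 0"
  proof (rule ccontr)
    assume "k \<noteq> 0"
    then have "q * q = 1" using inv(2) q by (simp add: mult.assoc mult.left_commute)
    then show False using pq ne by algebra
  qed
  then have hl: "h * l = 1" and k': "k' = 0" using H' by auto
  have inv2: "cnj a * h * b + cnj c * l * d = 0" "cnj a * h * a + cnj c * l * c = h"
    using H(3) \<open>k = 0\<close> k' by (simp_all add: B H_eq pullback_def)
  have "h * b = - cnj c * l"
  proof -
    have "h * b = (cnj a * h * a + cnj c * l * c) * b" using inv2 by simp
    also have "\<dots> = a * (cnj a * h * b) + cnj c * l * (b * c)" by (simp add: algebra_simps)
    also have "\<dots> = - cnj c * l * (a * d - b * c)" using inv2(1) by algebra
    finally show ?thesis using detB by simp
  qed
  then have hb: "h\<^sup>2 * b = - cnj c"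
    using hl by algebra
  have hr: "h = of_real (Re h)" using H'(1) by (simp add: of_real_Re)
  have "l = inverse h" using hl h0 by (simp add: field_simps)
  have b0: "b \<noteq> 0"
  proof
    assume "b = 0"
    then have "c = 0" using hb by simp
    with \<open>b = 0\<close> show False using assms(7) by (simp add: C zero_mat2)
  qed
  show thesis
  proof (rule that[of "Re h"])
    show "H = mat2 (of_real (Re h)) 0 0 (inverse (of_real (Re h)))"
      unfolding hr[symmetric] using H_eq \<open>k = 0\<close> k' \<open>l = inverse h\<close> by simp
    show "commutator A B $ 1 $ 2 \<noteq> 0" using b0 ne by (simp add: C)
    have "- cnj (commutator A B $ 2 $ 1) = (q - p) * cnj c" by (simp add: C q algebra_simps)
    also have "\<dots> = h\<^sup>2 * ((p - q) * b)" using hb by algebra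
    finally show "(of_real (Re h))\<^sup>2 = - cnj (commutator A B $ 2 $ 1) / commutator A B $ 1 $ 2"
      unfolding hr[symmetric] using b0 ne by (simp add: C)
  qed (use H' in simp)
qed

section \<open>Local analytic constructions in a coordinate\<close>

lemma eventually_at_ne: "\<forall>\<^sub>F x in at t. x \<noteq> (t::real)"
  by (simp add: eventually_at_filter)

lemma real_analytic_at_matrixI:
  fixes f :: "real \<Rightarrow> complex^2^2"
  assumes "real_analytic_at (\<lambda>x. f x $ 1 $ 1) t" "real_analytic_at (\<lambda>x. f x $ 1 $ 2) t"
    "real_analytic_at (\<lambda>x. f x $ 2 $ 1) t" "real_analytic_at (\<lambda>x. f x $ 2 $ 2) t"
  shows "real_analytic_at f t"
  using assms by (simp add: real_analytic_at_matrix_iff forall_2)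

lemma real_analytic_at_entry:
  fixes f :: "real \<Rightarrow> complex^2^2"
  shows "real_analytic_at f t \<Longrightarrow> real_analytic_at (\<lambda>x. f x $ i $ j) t"
  by (simp add: real_analytic_at_matrix_iff)

lemma isCont_entry:
  fixes f :: "real \<Rightarrow> complex^2^2"
  assumes "real_analytic_at f t"
  shows "((\<lambda>x. f x $ i $ j) \<longlongrightarrow> f t $ i $ j) (at t)"
  using real_analytic_at_isCont_complex[OF real_analytic_at_entry[OF assms]]
  by (simp add: isCont_def)

lemma matrix_inv_SL2: "V \<in> SL2 \<Longrightarrow> matrix_inv V = mat2 (V$2$2) (- V$1$2) (- V$2$1) (V$1$1)"
  by (cases V rule: mat2_cases) (simp add: SL2_def matrix_inv_mat2)

lemma real_analytic_at_matrix_inv: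
  assumes "real_analytic_at f t" "\<forall>\<^sub>F x in nhds t. f x \<in> SL2"
  shows "real_analytic_at (\<lambda>x. matrix_inv (f x)) t"
proof -
  have "\<forall>\<^sub>F x in nhds t.
      matrix_inv (f x) = mat2 (f x$2$2) (- f x$1$2) (- f x$2$1) (f x$1$1)"
    using assms(2) by eventually_elim (rule matrix_inv_SL2)
  moreover have "real_analytic_at (\<lambda>x. mat2 (f x$2$2) (- f x$1$2) (- f x$2$1) (f x$1$1)) t"
    using assms(1)
    by (intro real_analytic_at_matrixI)
      (auto intro!: real_analytic_intros real_analytic_at_entry)
  ultimately show ?thesis
    by (rule real_analytic_at_cong[THEN iffD2])
qed

lemma real_analytic_at_pullback:
  assumes "real_analytic_at f t" "real_analytic_at g t"
  shows "real_analytic_at (\<lambda>x. pullback (f x) (g x)) t"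
  unfolding pullback_def
  by (intro real_analytic_at_matrix_mult real_analytic_at_conj_transpose assms)

lemma pos_not_nonpos_Reals:
  assumes "z = complex_of_real r" "r > 0"
  shows "z \<notin> \<real>\<^sub>\<le>\<^sub>0"
  using assms by (simp add: complex_nonpos_Reals_iff)

lemma real_analytic_at_cholesky:
  assumes "real_analytic_at f t" "positive_form (f t)"
  shows "real_analytic_at (\<lambda>x. cholesky (f x)) t"
proof -
  have "f t $ 1 $ 1 \<notin> \<real>\<^sub>\<le>\<^sub>0"
    using assms(2) by (simp add: positive_form_def complex_nonpos_Reals_iff)
  moreover from this have "csqrt (f t $ 1 $ 1) \<noteq> 0" by auto
  ultimately show ?thesis
    unfolding cholesky_def using assms(1)
    by (intro real_analytic_at_matrixI)
      (auto intro!: real_analytic_intros real_analytic_at_entry)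
qed

lemma real_analytic_at_eq_at:
  fixes f g :: "real \<Rightarrow> complex ^ 'n ^ 'm"
  assumes "real_analytic_at f t" "real_analytic_at g t" "\<forall>\<^sub>F x in at t. f x = g x"
  shows "f t = g t"
proof -
  have "(f \<longlongrightarrow> f t) (at t)" "(g \<longlongrightarrow> g t) (at t)"
    using assms real_analytic_at_isCont by (auto simp: isCont_def)
  moreover from this(2) have "(f \<longlongrightarrow> g t) (at t)"
    using assms(3) by (subst tendsto_cong)
  ultimately show ?thesis
    using tendsto_unique trivial_limit_at by blast
qed

lemma quaternionic_at_limit:
  assumes "real_analytic_at f t" "\<forall>\<^sub>F x in at t. quaternionic (f x)"
  shows "quaternionic (f t)"
proof -
  note lim = isCont_entry[OF assms(1)]
  have "((\<lambda>x. f x $ 2 $ 2) \<longlongrightarrow> cnj (f t $ 1 $ 1)) (at t)"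
    by (rule Lim_transform_eventually[OF tendsto_cnj[OF lim]])
      (use assms(2) in eventually_elim, simp add: quaternionic_def)
  moreover have "((\<lambda>x. f x $ 1 $ 2) \<longlongrightarrow> - cnj (f t $ 2 $ 1)) (at t)"
    by (rule Lim_transform_eventually[OF tendsto_minus[OF tendsto_cnj[OF lim]]])
      (use assms(2) in eventually_elim, simp add: quaternionic_def)
  ultimately show ?thesis
    unfolding quaternionic_def using lim tendsto_unique trivial_limit_at by blast
qed

text \<open>Quaternions form a closed real subspace, so division by a power of the coordinate and passage to
  the limit stay inside it.\<close>

lemma quaternionic_leading_coefficient:
  assumes "real_analytic_at g t" "\<forall>\<^sub>F x in at t. quaternionic ((x - t) ^ n *\<^sub>R g x)"
  shows "\<forall>\<^sub>F x in nhds t. quaternionic (g x)"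
proof -
  have *: "\<forall>\<^sub>F x in at t. quaternionic (g x)"
    using assms(2) eventually_at_ne[of t]
  proof (eventually_elim)
    case (elim x)
    with quaternionic_scaleR[OF elim(1), of "inverse ((x - t) ^ n)"] show ?case by simp
  qed
  with quaternionic_at_limit[OF assms(1) *] show ?thesis
    by (simp add: eventually_nhds_conv_at)
qed

text \<open>Here \<open>S = \<tau> + \<mu> w\<close> for the traceless matrix \<open>w\<close> with entries \<open>\<alpha>\<close>, \<open>\<beta>\<close>, \<open>\<gamma>\<close> and determinant
  \<open>\<rho>\<^sup>2\<close>, and \<open>Q\<close> is \<open>w + \<rho> J\<close> scaled to determinant one, where \<open>J\<close> is diagonal with entries
  \<open>\<i>\<close> and \<open>- \<i>\<close>. Since \<open>w\<^sup>2 = - \<rho>\<^sup>2 = (\<rho> J)\<^sup>2\<close>, \<open>w (w + \<rho> J) = (w + \<rho> J) \<rho> J\<close>; moreover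
  \<open>w + \<rho> J\<close> is traceless, so it is its own inverse up to a scalar and conjugates in either
  direction.\<close>

lemma diagonal_of_scalar_plus_traceless:
  fixes \<alpha> \<beta> \<gamma> \<rho> \<delta> \<tau> \<mu> :: complex
  assumes "\<rho>\<^sup>2 = - \<alpha>\<^sup>2 - \<beta> * \<gamma>" "\<delta>\<^sup>2 = - (\<alpha> + \<rho> * \<i>)\<^sup>2 - \<beta> * \<gamma>" "\<delta> \<noteq> 0"
    and Q: "Q = mat2 ((\<alpha> + \<rho> * \<i>) / \<delta>) (\<beta> / \<delta>) (\<gamma> / \<delta>) (- (\<alpha> + \<rho> * \<i>) / \<delta>)"
    and S: "S = mat2 (\<tau> + \<mu> * \<alpha>) (\<mu> * \<beta>) (\<mu> * \<gamma>) (\<tau> - \<mu> * \<alpha>)"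
  shows "Q \<in> SL2" "is_diagonal (Q ** S ** matrix_inv Q)"
proof -
  define e where "e = \<alpha> + \<rho> * \<i>"
  have e: "\<rho> * \<i> = e - \<alpha>" by (simp add: e_def)
  have "(e - \<alpha>)\<^sup>2 = - \<rho>\<^sup>2" unfolding e[symmetric] by (simp add: power_mult_distrib)
  then have e2: "e * e = 2 * e * \<alpha> + \<beta> * \<gamma>"
    using assms(1) by algebra
  have d: "\<delta> * \<delta> = - e * e - \<beta> * \<gamma>"
    using assms(2) unfolding e_def[symmetric] by (simp add: power2_eq_square)
  show Q_SL2: "Q \<in> SL2"
  proof -
    have "det Q = (- e * e - \<beta> * \<gamma>) / (\<delta> * \<delta>)"
      unfolding Q e_def[symmetric] by (simp add: diff_divide_distrib)
    also have "\<dots> = 1"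
      unfolding d[symmetric] using assms(3) by simp
    finally show ?thesis by (simp add: SL2_def)
  qed
  show "is_diagonal (Q ** S ** matrix_inv Q)"
    unfolding is_diagonal_def forall_2 matrix_inv_SL2[OF Q_SL2]
    unfolding Q S e_def[symmetric]
    using assms(3) e2 by (simp add: field_simps)
qed

text \<open>Eigenvectors of an analytic family can jump where eigenvalues collide. For a quaternionic
  family they do not: unless it vanishes identically, its traceless part is a power of the
  coordinate times an analytic quaternionic family \<open>w\<close> with no zero near the point, so the
  determinant of \<open>w\<close> is positive there and has an analytic square root \<open>\<rho>\<close>. The matrix
  \<open>w + \<rho> J\<close> of \<open>diagonal_of_scalar_plus_traceless\<close> then does the job, provided it is invertible.\<close>

lemma quaternionic_locally_diagonalizable:
  fixes S :: "real \<Rightarrow> complex^2^2"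
  assumes S: "real_analytic_at S t" and quat: "\<forall>\<^sub>F x in nhds t. quaternionic (S x)"
  obtains Q where "real_analytic_at Q t" "\<forall>\<^sub>F x in nhds t. Q x \<in> SL2"
    "\<forall>\<^sub>F x in nhds t. is_diagonal (Q x ** S x ** matrix_inv (Q x))"
proof -
  define \<tau> where "\<tau> x = (S x $ 1 $ 1 + S x $ 2 $ 2) / 2" for x
  define u where "u x = S x - mat2 (\<tau> x) 0 0 (\<tau> x)" for x
  have u_entries: "u x $ 1 $ 1 = (S x $ 1 $ 1 - S x $ 2 $ 2) / 2" "u x $ 1 $ 2 = S x $ 1 $ 2"
    "u x $ 2 $ 1 = S x $ 2 $ 1" "u x $ 2 $ 2 = (S x $ 2 $ 2 - S x $ 1 $ 1) / 2" for x
    by (simp_all add: u_def \<tau>_def field_simps)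
  have S_eq: "S x = mat2 (\<tau> x + u x $ 1 $ 1) (u x $ 1 $ 2) (u x $ 2 $ 1) (\<tau> x - u x $ 1 $ 1)" for x
    by (subst mat2_eta) (simp add: u_entries \<tau>_def field_simps)
  have u_an: "real_analytic_at u t"
    by (rule real_analytic_at_matrixI; unfold u_entries)
      (auto intro!: real_analytic_intros real_analytic_at_entry S)
  from real_analytic_at_leading_term[OF u_an] show thesis
  proof (elim disjE exE conjE)
    assume zero: "\<forall>\<^sub>F x in nhds t. u x = 0"
    show thesis
    proof (rule that[of "\<lambda>x. mat 1"])
      show "real_analytic_at (\<lambda>x. mat 1 :: complex^2^2) t"
        by (rule real_analytic_at_matrixI) (simp_all add: mat_def real_analytic_at_const)
      show "\<forall>\<^sub>F x in nhds t. mat 1 \<in> SL2"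
        by (simp add: SL2_def)
      show "\<forall>\<^sub>F x in nhds t. is_diagonal (mat 1 ** S x ** matrix_inv (mat 1))"
        using zero
      proof eventually_elim
        case (elim x)
        then have "S x = mat2 (\<tau> x) 0 0 (\<tau> x)"
          by (subst S_eq) simp
        then show ?case
          by (simp add: matrix_inv_unique[of "mat 1"] is_diagonal_def forall_2)
      qed
    qed
  next
    fix n g
    assume g: "real_analytic_at g t" "g t \<noteq> 0" "\<forall>\<^sub>F x in nhds t. u x = (x - t) ^ n *\<^sub>R g x"
    \<comment> \<open>\<open>w + \<rho> J\<close> is quaternionic, so it is invertible unless \<open>w = - \<rho> J\<close>; the sign excludes this\<close>
    define \<sigma> :: real where "\<sigma> = (if Im (g t $ 1 $ 1) \<ge> 0 then 1 else - 1)"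
    have \<sigma>: "\<sigma> * \<sigma> = 1" "\<sigma> \<noteq> 0" by (simp_all add: \<sigma>_def)
    define w where "w x = \<sigma> *\<^sub>R g x" for x
    have w_an: "real_analytic_at w t"
      unfolding w_def using g(1) by (rule real_analytic_at_bounded_linear[OF bounded_linear_scaleR_right])
    have u_w: "\<forall>\<^sub>F x in nhds t. u x = (x - t) ^ n *\<^sub>R \<sigma> *\<^sub>R w x"
      using g(3) by (simp add: w_def \<sigma>(1))
    have "\<forall>\<^sub>F x in nhds t. quaternionic ((x - t) ^ n *\<^sub>R g x)"
      using quat g(3)
    proof eventually_elim
      case (elim x)
      have "quaternionic (u x)"
        using elim(1) by (simp add: quaternionic_def u_entries)
      then show ?case unfolding elim(2) .
    qed
    then have "\<forall>\<^sub>F x in nhds t. quaternionic (g x)"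
      by (intro quaternionic_leading_coefficient[OF g(1), where n = n]) (simp add: eventually_nhds_conv_at)
    then have w_quat: "quaternionic (w t)"
      unfolding w_def using eventually_nhds_x_imp_x quaternionic_scaleR by blast
    have tr: "\<forall>\<^sub>F x in at t. g x $ 2 $ 2 = - g x $ 1 $ 1"
      using g(3)[THEN eventually_nhds_conv_at[THEN iffD1, THEN conjunct1]]
        eventually_at_ne[of t]
    proof eventually_elim
      case (elim x)
      have "u x $ 2 $ 2 = - u x $ 1 $ 1" by (simp add: u_entries field_simps)
      then have "(x - t) ^ n *\<^sub>R (g x $ 2 $ 2) = (x - t) ^ n *\<^sub>R (- g x $ 1 $ 1)"
        using elim by simp
      then show ?case using elim by (simp only: scaleR_cancel_left) simp
    qed
    have "g t $ 2 $ 2 = - g t $ 1 $ 1"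
    proof (rule tendsto_unique[OF _ isCont_entry[OF g(1)]])
      show "((\<lambda>x. g x $ 2 $ 2) \<longlongrightarrow> - g t $ 1 $ 1) (at t)"
        by (rule Lim_transform_eventually[OF tendsto_minus[OF isCont_entry[OF g(1)]]])
          (use tr in eventually_elim, simp)
    qed simp
    with tr have "\<forall>\<^sub>F x in nhds t. g x $ 2 $ 2 = - g x $ 1 $ 1"
      by (simp add: eventually_nhds_conv_at)
    then have w_tr: "\<forall>\<^sub>F x in nhds t. w x $ 2 $ 2 = - w x $ 1 $ 1"
      by eventually_elim (simp add: w_def)
    then have w_tr_t: "w t $ 2 $ 2 = - w t $ 1 $ 1"
      using eventually_nhds_x_imp_x by blast
    have w_ne: "w t \<noteq> 0" using g(2) \<sigma>(2) by (simp add: w_def)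
    have w_Im: "Im (w t $ 1 $ 1) \<ge> 0" by (simp add: w_def \<sigma>_def)
    define D where "D x = - (w x $ 1 $ 1)\<^sup>2 - w x $ 1 $ 2 * w x $ 2 $ 1" for x
    have "D t = det (w t)" by (simp add: D_def det_2 w_tr_t power2_eq_square)
    then obtain d where d: "D t = of_real d" "d > 0"
      using quaternionic_det[OF w_quat] quaternionic_det_eq_0_iff[OF w_quat] w_ne
      by (metis add_nonneg_nonneg less_eq_real_def of_real_0 zero_le_power2)
    define \<rho> where "\<rho> x = csqrt (D x)" for x
    have D_an: "real_analytic_at D t"
      unfolding D_def power2_eq_square using w_an
      by (auto intro!: real_analytic_intros real_analytic_at_entry)
    have \<rho>_an: "real_analytic_at \<rho> t"
      unfolding \<rho>_def using D_an pos_not_nonpos_Reals[OF d] by (rule real_analytic_at_csqrt)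
    have \<rho>_t: "\<rho> t = of_real (sqrt d)"
      unfolding \<rho>_def d(1) using of_real_sqrt[of d] d(2) by simp
    define e where "e x = w x $ 1 $ 1 + \<rho> x * \<i>" for x
    define E where "E x = - (e x)\<^sup>2 - w x $ 1 $ 2 * w x $ 2 $ 1" for x
    have e_an: "real_analytic_at e t"
      unfolding e_def using w_an \<rho>_an by (auto intro!: real_analytic_intros real_analytic_at_entry)
    have E_an: "real_analytic_at E t"
      unfolding E_def power2_eq_square using w_an e_an
      by (auto intro!: real_analytic_intros real_analytic_at_entry)
    have e_t: "cnj (e t) = - e t"
    proof -
      have "cnj (w t $ 1 $ 1) = - w t $ 1 $ 1"
        using w_quat w_tr_t by (simp add: quaternionic_def)
      then show ?thesis by (simp add: e_def \<rho>_t)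
    qed
    have "Im (e t) > 0"
      using w_Im d(2) by (simp add: e_def \<rho>_t add_nonneg_pos)
    then have "cmod (e t) > 0" by auto
    have "E t = e t * cnj (e t) + w t $ 2 $ 1 * cnj (w t $ 2 $ 1)"
      using w_quat unfolding quaternionic_def e_t by (simp add: E_def power2_eq_square)
    also have "\<dots> = of_real ((cmod (e t))\<^sup>2 + (cmod (w t $ 2 $ 1))\<^sup>2)"
      by (simp only: complex_norm_square[symmetric] of_real_add)
    finally have E_t: "E t \<notin> \<real>\<^sub>\<le>\<^sub>0"
      by (rule pos_not_nonpos_Reals) (use \<open>cmod (e t) > 0\<close> in \<open>simp add: add_pos_nonneg\<close>)
    define \<delta> where "\<delta> x = csqrt (E x)" for x
    have \<delta>_an: "real_analytic_at \<delta> t"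
      unfolding \<delta>_def using E_an E_t by (rule real_analytic_at_csqrt)
    have \<delta>_t: "\<delta> t \<noteq> 0" using E_t by (auto simp: \<delta>_def)
    have \<delta>_ne: "\<forall>\<^sub>F x in nhds t. \<delta> x \<noteq> 0"
      using real_analytic_at_isCont_complex[OF \<delta>_an] \<delta>_t
      by (simp add: eventually_nhds_conv_at isCont_def tendsto_imp_eventually_ne)
    define Q where "Q x = mat2 (e x / \<delta> x) (w x $ 1 $ 2 / \<delta> x) (w x $ 2 $ 1 / \<delta> x) (- e x / \<delta> x)" for x
    have Q: "\<forall>\<^sub>F x in nhds t. Q x \<in> SL2 \<and> is_diagonal (Q x ** S x ** matrix_inv (Q x))"
      using \<delta>_ne u_w w_tr
    proof eventually_elim
      case (elim x)
      let ?\<mu> = "of_real ((x - t) ^ n * \<sigma>) :: complex"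
      have "S x = mat2 (\<tau> x + ?\<mu> * w x $ 1 $ 1) (?\<mu> * w x $ 1 $ 2) (?\<mu> * w x $ 2 $ 1)
          (\<tau> x - ?\<mu> * w x $ 1 $ 1)"
      proof -
        have "u x $ i $ j = ?\<mu> * w x $ i $ j" for i j
          unfolding elim(2) vector_scaleR_component
          by (simp add: scaleR_conv_of_real[where 'a = complex] mult.assoc)
        then show ?thesis by (subst S_eq) simp
      qed
      from diagonal_of_scalar_plus_traceless[OF _ _ elim(1) refl this, of "\<rho> x"]
      show ?case
        by (simp add: Q_def e_def \<rho>_def D_def \<delta>_def E_def)
    qed
    show thesis
    proof (rule that[of Q])
      show "real_analytic_at Q t"
        unfolding Q_def using w_an e_an \<delta>_an \<delta>_t
        by (intro real_analytic_at_matrixI) (auto intro!: real_analytic_intros real_analytic_at_entry)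
    qed (use Q in \<open>auto elim: eventually_mono\<close>)
  qed
qed

lemma commutator_diagonal:
  assumes "is_diagonal A"
  shows "commutator A B $ 1 $ 1 = 0" "commutator A B $ 2 $ 2 = 0"
proof -
  have "A $ 1 $ 2 = 0" "A $ 2 $ 1 = 0"
    using assms by (simp_all add: is_diagonal_def)
  then show "commutator A B $ 1 $ 1 = 0" "commutator A B $ 2 $ 2 = 0"
    by (simp_all add: commutator_def matrix_matrix_mult_def sum_2)
qed

text \<open>The form is constructed in the frame \<open>V\<close>, where \<open>invariant_form_of_diagonal\<close> expresses it by
  the entries of the commutator \<open>(x - t)\<^sup>n g1 x\<close>. The real factor cancels in the quotient \<open>\<theta>\<close>, which
  thereby makes sense at \<open>t\<close> too. Positivity of \<open>\<theta>\<close> near \<open>t\<close> is inherited from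
  the invariant forms that exist there.\<close>

lemma local_invariant_form:
  fixes A B V g :: "real \<Rightarrow> complex^2^2"
  assumes V: "real_analytic_at V t" "\<forall>\<^sub>F x in nhds t. V x \<in> SL2"
    "\<forall>\<^sub>F x in nhds t. is_diagonal (V x ** A x ** matrix_inv (V x))"
    and AB: "\<forall>\<^sub>F x in nhds t. A x \<in> SL2 \<and> B x \<in> SL2"
    and g: "real_analytic_at g t" "det (g t) \<noteq> 0"
      "\<forall>\<^sub>F x in nhds t. commutator (A x) (B x) = (x - t) ^ n *\<^sub>R g x"
    and inv: "\<forall>\<^sub>F x in at t. \<exists>K. positive_form K \<and> pullback (A x) K = K \<and> pullback (B x) K = K"
  obtains H where "real_analytic_at H t" "positive_form (H t)"
    "\<forall>\<^sub>F x in at t. \<forall>K. positive_form K \<longrightarrow> pullback (A x) K = K \<longrightarrow> pullback (B x) K = K \<longrightarrow> H x = K"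
proof -
  define g1 where "g1 x = V x ** g x ** matrix_inv (V x)" for x
  have g1_an: "real_analytic_at g1 t"
    unfolding g1_def
    by (intro real_analytic_at_matrix_mult real_analytic_at_matrix_inv V g)
  have at_of_nhds: "\<forall>\<^sub>F x in at t. P x" if "\<forall>\<^sub>F x in nhds t. P x" for P
    using that by (simp add: eventually_nhds_conv_at)
  have V_t: "V t \<in> SL2" using V(2) eventually_nhds_x_imp_x by blast
  define A1 where "A1 x = V x ** A x ** matrix_inv (V x)" for x
  define B1 where "B1 x = V x ** B x ** matrix_inv (V x)" for x
  have "g t \<noteq> 0" using g(2) by (auto simp: zero_mat2)
  then have ne: "\<forall>\<^sub>F x in at t. commutator (A x) (B x) \<noteq> 0"
    by (rule eventually_at_nonzero_of_leading_term[OF g(1) _ g(3)])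
  have near: "\<forall>\<^sub>F x in at t. V x \<in> SL2 \<and> A1 x \<in> SL2 \<and> B1 x \<in> SL2 \<and> is_diagonal (A1 x) \<and>
      commutator (A1 x) (B1 x) \<noteq> 0 \<and> commutator (A1 x) (B1 x) = (x - t) ^ n *\<^sub>R g1 x \<and> x \<noteq> t"
    using V(2,3)[THEN at_of_nhds] AB[THEN at_of_nhds] g(3)[THEN at_of_nhds] ne
      eventually_at_ne[of t]
  proof eventually_elim
    case (elim x)
    then have "A1 x \<in> SL2" "B1 x \<in> SL2"
      unfolding A1_def B1_def using SL2_mult SL2_inverse(3) by blast+
    moreover have c: "commutator (A1 x) (B1 x) = V x ** commutator (A x) (B x) ** matrix_inv (V x)"
      unfolding A1_def B1_def using elim(1) by (rule commutator_conjugate)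
    moreover have "commutator (A1 x) (B1 x) \<noteq> 0"
      unfolding c using conjugate_eq_0_iff elim by blast
    moreover have "commutator (A1 x) (B1 x) = (x - t) ^ n *\<^sub>R g1 x"
      unfolding c g1_def elim(4) by (rule conjugate_scaleR)
    ultimately show ?case using elim by (simp add: A1_def)
  qed
  have "g1 t $ i $ i = 0" for i :: 2
  proof (rule tendsto_unique[OF _ isCont_entry[OF g1_an]])
    show "((\<lambda>x. g1 x $ i $ i) \<longlongrightarrow> 0) (at t)"
    proof (rule tendsto_eventually)
      show "\<forall>\<^sub>F x in at t. g1 x $ i $ i = 0"
        using near
      proof eventually_elim
        case (elim x)
        then have "commutator (A1 x) (B1 x) $ i $ i = 0"
          using commutator_diagonal[of "A1 x" "B1 x"] exhaust_2[of i] by auto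
        then show ?case using elim by simp
      qed
    qed
  qed simp
  then have "det (g1 t) = - (g1 t $ 1 $ 2 * g1 t $ 2 $ 1)"
    by (simp add: det_2)
  moreover have "det (g1 t) \<noteq> 0"
    unfolding g1_def det_conjugate[OF V_t] by (rule g(2))
  ultimately have g1_ne: "g1 t $ 1 $ 2 \<noteq> 0" "g1 t $ 2 $ 1 \<noteq> 0" by auto
  define \<theta> where "\<theta> x = - cnj (g1 x $ 2 $ 1) / g1 x $ 1 $ 2" for x
  have \<theta>_an: "real_analytic_at \<theta> t"
    unfolding \<theta>_def using g1_an g1_ne by (auto intro!: real_analytic_intros real_analytic_at_entry)
  define H1 where "H1 x = mat2 (csqrt (\<theta> x)) 0 0 (inverse (csqrt (\<theta> x)))" for x
  have key: "\<forall>\<^sub>F x in at t. \<forall>K. positive_form K \<longrightarrow> pullback (A x) K = K \<longrightarrow> pullback (B x) K = K \<longrightarrow>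
      pullback (V x) (H1 x) = K \<and> (\<exists>h>0. \<theta> x = of_real h)"
    using near
  proof (eventually_elim, intro allI impI)
    fix x K
    assume x: "V x \<in> SL2 \<and> A1 x \<in> SL2 \<and> B1 x \<in> SL2 \<and> is_diagonal (A1 x) \<and>
      commutator (A1 x) (B1 x) \<noteq> 0 \<and> commutator (A1 x) (B1 x) = (x - t) ^ n *\<^sub>R g1 x \<and> x \<noteq> t"
      and K: "positive_form K" "pullback (A x) K = K" "pullback (B x) K = K"
    define L where "L = pullback (matrix_inv (V x)) K"
    have VSL: "V x \<in> SL2" using x by blast
    have K_L: "K = pullback (V x) L"
      unfolding L_def using pullback_inverse(1)[OF VSL] by simp
    have "positive_form L"
      unfolding L_def using positive_form_pullback SL2_inverse(3)[OF VSL] K(1) by blast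
    moreover have "pullback (A1 x) L = L" "pullback (B1 x) L = L"
      using K(2,3) unfolding K_L A1_def B1_def invariant_pullback_iff[OF VSL] .
    ultimately obtain h where h: "h > 0" "L = mat2 (of_real h) 0 0 (inverse (of_real h))"
      "(of_real h)\<^sup>2 = - cnj (commutator (A1 x) (B1 x) $ 2 $ 1) / commutator (A1 x) (B1 x) $ 1 $ 2"
      using invariant_form_of_diagonal[of L "A1 x" "B1 x"] x by metis
    have "(of_real h)\<^sup>2 = \<theta> x"
    proof -
      have c: "commutator (A1 x) (B1 x) $ i $ j = of_real ((x - t) ^ n) * g1 x $ i $ j" for i j
      proof -
        have "commutator (A1 x) (B1 x) = (x - t) ^ n *\<^sub>R g1 x" using x by blast
        then show ?thesis
          by (simp only: vector_scaleR_component) (simp only: scaleR_conv_of_real)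
      qed
      have cancel: "- (r * z) / (r * z') = - z / z'" if "r \<noteq> 0" for r z z' :: complex
        using that by simp
      have "of_real ((x - t) ^ n) \<noteq> (0 :: complex)" using x by simp
      then show ?thesis
        unfolding h(3) c \<theta>_def complex_cnj_mult complex_cnj_complex_of_real by (rule cancel)
    qed
    then have \<theta>: "\<theta> x = of_real (h\<^sup>2)" by simp
    then have "csqrt (\<theta> x) = of_real h"
      using h(1) by (metis csqrt_of_real_nonneg less_imp_le of_real_power csqrt_square Re_complex_of_real)
    then have "H1 x = L" by (simp add: H1_def h(2))
    then show "pullback (V x) (H1 x) = K \<and> (\<exists>h>0. \<theta> x = of_real h)"
      using K_L \<theta> h(1) by (auto intro!: exI[of _ "h\<^sup>2"])
  qed
  have "\<forall>\<^sub>F x in at t. \<theta> x \<in> \<real>\<^sub>\<ge>\<^sub>0"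
    using key inv by eventually_elim (auto simp: less_imp_le)
  then have "\<theta> t \<in> \<real>\<^sub>\<ge>\<^sub>0"
    using real_analytic_at_isCont_complex[OF \<theta>_an] Lim_in_closed_set[OF closed_nonneg_Reals_complex]
    by (metis isCont_def trivial_limit_at)
  moreover have "\<theta> t \<noteq> 0" using g1_ne by (simp add: \<theta>_def)
  ultimately obtain d where d: "\<theta> t = of_real d" "d > 0"
    by (metis nonneg_Reals_cases of_real_0 order_le_less)
  have csq: "csqrt (\<theta> t) = of_real (sqrt d)"
    unfolding d(1) using of_real_sqrt[of d] d(2) by simp
  show thesis
  proof (rule that[of "\<lambda>x. pullback (V x) (H1 x)"])
    have "csqrt (\<theta> t) \<noteq> 0" using csq d(2) by simp
    then have "real_analytic_at H1 t"
      unfolding H1_def using \<theta>_an pos_not_nonpos_Reals[OF d]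
      by (intro real_analytic_at_matrixI) (auto intro!: real_analytic_intros)
    then show "real_analytic_at (\<lambda>x. pullback (V x) (H1 x)) t"
      by (rule real_analytic_at_pullback[OF V(1)])
    have "positive_form (H1 t)"
      using d(2) \<open>csqrt (\<theta> t) \<noteq> 0\<close> by (simp add: H1_def csq positive_form_mat2)
    then show "positive_form (pullback (V t) (H1 t))"
      by (rule positive_form_pullback[OF V_t])
    show "\<forall>\<^sub>F x in at t. \<forall>K. positive_form K \<longrightarrow> pullback (A x) K = K \<longrightarrow> pullback (B x) K = K \<longrightarrow>
        pullback (V x) (H1 x) = K"
      using key by eventually_elim blast
  qed
qed

section \<open>Analytic functions on a curve\<close>

text \<open>A chart translates between neighbourhood filters of the curve and of the real line; every
  local statement below is moved to the line through this lemma.\<close>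

lemma chart_eventually_nhds:
  assumes "analytic_curve X \<A>" "(U, \<phi>) \<in> \<A>" "p \<in> U"
  shows "eventually P (nhdsin X p) \<longleftrightarrow> (\<forall>\<^sub>F x in nhds (\<phi> p). P (inv_into U \<phi> x))"
    and "\<forall>\<^sub>F x in nhds (\<phi> p). x \<in> \<phi> ` U"
    and "inj_on \<phi> U" and "p \<in> topspace X"
proof -
  have chart: "openin X U" "open (\<phi> ` U)"
    "homeomorphic_map (subtopology X U) (top_of_set (\<phi> ` U)) \<phi>"
    using assms(1,2) by (auto simp: analytic_curve_def curve_chart_def)
  have U: "U \<subseteq> topspace X" using chart(1) by (rule openin_subset)
  show inj: "inj_on \<phi> U"
    using homeomorphic_imp_injective_map[OF chart(3)] U by (simp add: Int_absorb1)
  show p: "p \<in> topspace X" using U assms(3) by blast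
  show "\<forall>\<^sub>F x in nhds (\<phi> p). x \<in> \<phi> ` U"
    using chart(2) assms(3) by (simp add: eventually_nhds_in_open)
  show "eventually P (nhdsin X p) \<longleftrightarrow> (\<forall>\<^sub>F x in nhds (\<phi> p). P (inv_into U \<phi> x))"
  proof
    assume "eventually P (nhdsin X p)"
    then obtain N where N: "openin X N" "p \<in> N" "\<forall>y\<in>N. P y"
      using p unfolding eventually_nhdsin by blast
    have "openin (subtopology X U) (U \<inter> N)"
      using N(1) by (auto simp: openin_subtopology)
    then have "openin (top_of_set (\<phi> ` U)) (\<phi> ` (U \<inter> N))"
      using homeomorphic_imp_open_map[OF chart(3)] by (auto simp: open_map_def)
    then have "open (\<phi> ` (U \<inter> N))"
      using chart(2) openin_open_trans by blast
    then have "\<forall>\<^sub>F x in nhds (\<phi> p). x \<in> \<phi> ` (U \<inter> N)"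
      using assms(3) N(2) by (intro eventually_nhds_in_open) auto
    then show "\<forall>\<^sub>F x in nhds (\<phi> p). P (inv_into U \<phi> x)"
      by eventually_elim (use N(3) inj in auto)
  next
    assume "\<forall>\<^sub>F x in nhds (\<phi> p). P (inv_into U \<phi> x)"
    then obtain S where S: "open S" "\<phi> p \<in> S" "\<forall>x\<in>S. P (inv_into U \<phi> x)"
      unfolding eventually_nhds by blast
    have "openin (top_of_set (\<phi> ` U)) (\<phi> ` U \<inter> S)"
      using S(1) by (simp add: openin_open_Int)
    then have "openin (subtopology X U) {y \<in> topspace (subtopology X U). \<phi> y \<in> \<phi> ` U \<inter> S}"
      using homeomorphic_imp_continuous_map[OF chart(3)] by (rule openin_continuous_map_preimage[rotated])
    then have N: "openin X {y \<in> U. \<phi> y \<in> S}"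
    proof -
      have "{y \<in> topspace (subtopology X U). \<phi> y \<in> \<phi> ` U \<inter> S} = {y \<in> U. \<phi> y \<in> S}"
        using U by auto
      then show ?thesis
        using \<open>openin (subtopology X U) _\<close> chart(1) openin_trans_full by metis
    qed
    show "eventually P (nhdsin X p)"
      unfolding eventually_nhdsin
    proof (intro disjI2 exI[of _ "{y \<in> U. \<phi> y \<in> S}"] conjI ballI N)
      show "p \<in> {y \<in> U. \<phi> y \<in> S}" using assms(3) S(2) by simp
      show "P y" if "y \<in> {y \<in> U. \<phi> y \<in> S}" for y
      proof -
        have "P (inv_into U \<phi> (\<phi> y))" using that S(3) by blast
        then show ?thesis using that inj by simp
      qed
    qed
  qed
qed

lemma eventually_nhdsin_iff_atin:
  assumes "p \<in> topspace X"
  shows "eventually P (nhdsin X p) \<longleftrightarrow> P p \<and> eventually P (atin X p)"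
  using assms unfolding eventually_nhdsin eventually_atin by blast

lemma chart_eventually_at:
  assumes "analytic_curve X \<A>" "(U, \<phi>) \<in> \<A>" "p \<in> U"
  shows "eventually P (atin X p) \<longleftrightarrow> (\<forall>\<^sub>F x in at (\<phi> p). P (inv_into U \<phi> x))"
proof -
  note chart = chart_eventually_nhds[OF assms]
  have "eventually P (atin X p) \<longleftrightarrow> eventually (\<lambda>y. y \<noteq> p \<longrightarrow> P y) (nhdsin X p)"
    using chart(4) unfolding eventually_nhdsin eventually_atin by blast
  also have "\<dots> \<longleftrightarrow> (\<forall>\<^sub>F x in nhds (\<phi> p). inv_into U \<phi> x \<noteq> p \<longrightarrow> P (inv_into U \<phi> x))"
    by (rule chart(1))
  also have "\<dots> \<longleftrightarrow> (\<forall>\<^sub>F x in nhds (\<phi> p). x \<noteq> \<phi> p \<longrightarrow> P (inv_into U \<phi> x))"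
    by (rule eventually_subst)
      (use chart(2) in eventually_elim, use chart(3) assms(3) in auto)
  finally show ?thesis
    by (simp add: eventually_at_filter)
qed

text \<open>Transition maps are analytic, so a single chart decides analyticity.\<close>

lemma analytic_at_point_iff:
  fixes f :: "'a \<Rightarrow> complex ^ 'n ^ 'm"
  assumes "analytic_curve X \<A>" "(U, \<phi>) \<in> \<A>" "p \<in> U"
  shows "analytic_at_point \<A> f p \<longleftrightarrow> real_analytic_at (f \<circ> inv_into U \<phi>) (\<phi> p)"
proof
  assume "analytic_at_point \<A> f p"
  then show "real_analytic_at (f \<circ> inv_into U \<phi>) (\<phi> p)"
    using assms(2,3) unfolding analytic_at_point_def by blast
next
  assume an: "real_analytic_at (f \<circ> inv_into U \<phi>) (\<phi> p)"
  have "real_analytic_at (f \<circ> inv_into W \<psi>) (\<psi> p)" if W: "(W, \<psi>) \<in> \<A>" "p \<in> W" for W \<psi>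
  proof -
    note chartU = chart_eventually_nhds[OF assms]
    note chartW = chart_eventually_nhds[OF assms(1) W]
    have "analytically_compatible (W, \<psi>) (U, \<phi>)"
      using assms(1,2) W(1) unfolding analytic_curve_def by blast
    then have "real_analytic_at (\<phi> \<circ> inv_into W \<psi>) (\<psi> p)"
      using assms(3) W(2) by (simp add: analytically_compatible_def)
    moreover have "(\<phi> \<circ> inv_into W \<psi>) (\<psi> p) = \<phi> p"
      using chartW(3) W(2) by simp
    ultimately have "real_analytic_at ((f \<circ> inv_into U \<phi>) \<circ> (\<phi> \<circ> inv_into W \<psi>)) (\<psi> p)"
      using an by (intro real_analytic_at_compose) simp_all
    moreover have "\<forall>\<^sub>F y in nhdsin X p. y \<in> U"
      using assms chartU(4) unfolding eventually_nhdsin analytic_curve_def curve_chart_def by blast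
    then have "\<forall>\<^sub>F x in nhds (\<psi> p). inv_into W \<psi> x \<in> U"
      unfolding chartW(1) .
    then have "\<forall>\<^sub>F x in nhds (\<psi> p). (f \<circ> inv_into W \<psi>) x =
        ((f \<circ> inv_into U \<phi>) \<circ> (\<phi> \<circ> inv_into W \<psi>)) x"
      by eventually_elim (use chartU(3) in simp)
    ultimately show ?thesis
      using real_analytic_at_cong by blast
  qed
  then show "analytic_at_point \<A> f p"
    unfolding analytic_at_point_def by blast
qed

lemma curve_chart_exists:
  assumes "analytic_curve X \<A>" "p \<in> topspace X"
  obtains U \<phi> where "(U, \<phi>) \<in> \<A>" "p \<in> U"
  using assms unfolding analytic_curve_def by (metis UN_E prod.collapse)

lemma analytic_at_point_cong:
  fixes f g :: "'a \<Rightarrow> complex ^ 'n ^ 'm"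
  assumes C: "analytic_curve X \<A>" "p \<in> topspace X" and "\<forall>\<^sub>F y in nhdsin X p. f y = g y"
    and "analytic_at_point \<A> g p"
  shows "analytic_at_point \<A> f p"
proof -
  obtain U \<phi> where U: "(U, \<phi>) \<in> \<A>" "p \<in> U" using curve_chart_exists[OF C] .
  have "\<forall>\<^sub>F x in nhds (\<phi> p). (f \<circ> inv_into U \<phi>) x = (g \<circ> inv_into U \<phi>) x"
    using assms(3) chart_eventually_nhds(1)[OF C(1) U] by simp
  then show ?thesis
    using assms(4) unfolding analytic_at_point_iff[OF C(1) U] by (rule real_analytic_at_cong[THEN iffD2])
qed

lemma eventually_analytic_at_point:
  fixes f :: "'a \<Rightarrow> complex ^ 'n ^ 'm"
  assumes C: "analytic_curve X \<A>" "p \<in> topspace X" and "analytic_at_point \<A> f p"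
  shows "\<forall>\<^sub>F y in nhdsin X p. analytic_at_point \<A> f y"
proof -
  obtain U \<phi> where U: "(U, \<phi>) \<in> \<A>" "p \<in> U" using curve_chart_exists[OF C] .
  have "\<forall>\<^sub>F x in nhds (\<phi> p). real_analytic_at (f \<circ> inv_into U \<phi>) x"
    using assms(3) unfolding analytic_at_point_iff[OF C(1) U] by (rule eventually_real_analytic_at)
  then have "\<forall>\<^sub>F x in nhds (\<phi> p). analytic_at_point \<A> f (inv_into U \<phi> x)"
    using chart_eventually_nhds(2)[OF C(1) U]
    by eventually_elim
      (simp add: analytic_at_point_iff[OF C(1) U(1)] inv_into_into f_inv_into_f)
  then show ?thesis
    unfolding chart_eventually_nhds(1)[OF C(1) U] .
qed

lemma analytic_at_point_matrix_mult:
  fixes f g :: "'a \<Rightarrow> complex^2^2"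
  assumes "analytic_at_point \<A> f p" "analytic_at_point \<A> g p"
  shows "analytic_at_point \<A> (\<lambda>y. f y ** g y) p"
  using assms unfolding analytic_at_point_def by (auto simp: o_def intro!: real_analytic_at_matrix_mult)

lemma analytic_at_point_commutator:
  assumes "analytic_at_point \<A> f p" "analytic_at_point \<A> g p"
  shows "analytic_at_point \<A> (\<lambda>y. commutator (f y) (g y)) p"
  using assms unfolding analytic_at_point_def by (auto simp: o_def intro!: real_analytic_at_commutator)

lemma analytic_at_point_pullback:
  assumes "analytic_at_point \<A> f p" "analytic_at_point \<A> g p"
  shows "analytic_at_point \<A> (\<lambda>y. pullback (f y) (g y)) p"
  using assms unfolding analytic_at_point_def by (auto simp: o_def intro!: real_analytic_at_pullback)

lemma analytic_at_point_eq:
  fixes f g :: "'a \<Rightarrow> complex ^ 'n ^ 'm"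
  assumes C: "analytic_curve X \<A>" "p \<in> topspace X"
    and "analytic_at_point \<A> f p" "analytic_at_point \<A> g p" "\<forall>\<^sub>F y in atin X p. f y = g y"
  shows "f p = g p"
proof -
  obtain U \<phi> where U: "(U, \<phi>) \<in> \<A>" "p \<in> U" using curve_chart_exists[OF C] .
  have "(f \<circ> inv_into U \<phi>) (\<phi> p) = (g \<circ> inv_into U \<phi>) (\<phi> p)"
    using assms(3-5) unfolding analytic_at_point_iff[OF C(1) U] chart_eventually_at[OF C(1) U]
    unfolding o_def by (intro real_analytic_at_eq_at)
  then show ?thesis
    using chart_eventually_nhds(3)[OF C(1) U] U(2) by simp
qed

text \<open>Identity theorem: the points near which an analytic map vanishes form a set that is open
  by definition and closed because zeros are otherwise isolated.\<close>

lemma eventually_nonzero_on_curve: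
  fixes f :: "'a \<Rightarrow> complex ^ 'n ^ 'm"
  assumes C: "analytic_curve X \<A>" and an: "\<forall>p\<in>topspace X. analytic_at_point \<A> f p"
    and "\<exists>p\<in>topspace X. f p \<noteq> 0" and p: "p \<in> topspace X"
  shows "\<forall>\<^sub>F y in atin X p. f y \<noteq> 0"
proof -
  define Z where "Z = {y \<in> topspace X. \<forall>\<^sub>F z in nhdsin X y. f z = 0}"
  have dich: "(\<forall>\<^sub>F z in nhdsin X y. f z = 0) \<or> (\<forall>\<^sub>F z in atin X y. f z \<noteq> 0)"
    if y: "y \<in> topspace X" for y
  proof -
    obtain U \<phi> where U: "(U, \<phi>) \<in> \<A>" "y \<in> U" using curve_chart_exists[OF C y] .
    have "real_analytic_at (f \<circ> inv_into U \<phi>) (\<phi> y)"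
      using an y analytic_at_point_iff[OF C U] by blast
    from real_analytic_at_eventually_zero_or_nonzero[OF this] show ?thesis
      unfolding chart_eventually_at[OF C U] chart_eventually_nhds(1)[OF C U] by simp
  qed
  have "openin X Z"
  proof (subst openin_subopen, intro ballI)
    fix y assume "y \<in> Z"
    then obtain N where N: "openin X N" "y \<in> N" "\<forall>z\<in>N. f z = 0"
      unfolding Z_def eventually_nhdsin by blast
    then have "N \<subseteq> Z"
      unfolding Z_def eventually_nhdsin using openin_subset by blast
    with N show "\<exists>T. openin X T \<and> y \<in> T \<and> T \<subseteq> Z" by blast
  qed
  moreover have "openin X (topspace X - Z)"
  proof (subst openin_subopen, intro ballI)
    fix y assume y: "y \<in> topspace X - Z"
    then have "\<forall>\<^sub>F z in atin X y. f z \<noteq> 0"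
      using dich unfolding Z_def by blast
    then obtain N where N: "openin X N" "y \<in> N" "\<forall>z\<in>N - {y}. f z \<noteq> 0"
      using y unfolding eventually_atin by blast
    have "z \<notin> Z" if "z \<in> N" for z
    proof (cases "z = y")
      case False
      then have "f z \<noteq> 0" using N(3) that by blast
      then show ?thesis
        unfolding Z_def eventually_nhdsin by blast
    qed (use y in blast)
    then show "\<exists>T. openin X T \<and> y \<in> T \<and> T \<subseteq> topspace X - Z"
      using N openin_subset by blast
  qed
  ultimately have "openin X Z" "closedin X Z"
    by (auto simp: closedin_def Z_def)
  then have "Z = {} \<or> Z = topspace X"
    using C connected_space_clopen_in[of X] unfolding analytic_curve_def by blast
  moreover obtain q where "q \<in> topspace X" "f q \<noteq> 0" using assms(3) by blast
  then have "q \<notin> Z" unfolding Z_def eventually_nhdsin by blast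
  ultimately have "Z = {}" using \<open>q \<in> topspace X\<close> by blast
  then show ?thesis
    using dich[OF p] p unfolding Z_def by blast
qed

section \<open>Gluing the invariant form\<close>

lemma pointwise_unitarizable_iff_form:
  assumes "\<forall>k\<in>{1..q}. M k p \<in> SL2"
  shows "pointwise_simultaneously_unitarizable q M p \<longleftrightarrow>
    (\<exists>K. positive_form K \<and> (\<forall>k\<in>{1..q}. pullback (M k p) K = K))"
proof
  assume "pointwise_simultaneously_unitarizable q M p"
  then obtain V where V: "V \<in> SL2" "\<forall>k\<in>{1..q}. V ** M k p ** matrix_inv V \<in> SU2"
    unfolding pointwise_simultaneously_unitarizable_def by blast
  then show "\<exists>K. positive_form K \<and> (\<forall>k\<in>{1..q}. pullback (M k p) K = K)"
    using positive_form_pullback[OF V(1) positive_form_mat_1] conjugate_in_SU2_iff assms by blast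
next
  assume "\<exists>K. positive_form K \<and> (\<forall>k\<in>{1..q}. pullback (M k p) K = K)"
  then obtain K where K: "positive_form K" "\<forall>k\<in>{1..q}. pullback (M k p) K = K" by blast
  then show "pointwise_simultaneously_unitarizable q M p"
    unfolding pointwise_simultaneously_unitarizable_def
    using cholesky[OF K(1)] conjugate_in_SU2_iff assms by (intro bexI[of _ "cholesky K"]) auto
qed

lemma commutator_swap: "commutator B A = - commutator A B"
  by (simp add: commutator_def)

text \<open>The hypothesis on irreducibility is symmetric in \<open>A\<close> and \<open>B\<close> so that either matrix of the pair
  may be the one that is diagonalized.\<close>

lemma invariant_form_near_point:
  fixes A B :: "'a \<Rightarrow> complex^2^2"
  assumes C: "analytic_curve X \<A>" "p \<in> topspace X"
    and SL: "\<forall>y\<in>topspace X. A y \<in> SL2 \<and> B y \<in> SL2"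
    and diag: "locally_diagonalizable X \<A> A p"
    and irr: "infinitesimally_irreducible X \<A> A B p \<or> infinitesimally_irreducible X \<A> B A p"
    and inv: "\<forall>y\<in>topspace X. \<exists>K. positive_form K \<and> pullback (A y) K = K \<and> pullback (B y) K = K"
  obtains H where "analytic_at_point \<A> H p" "positive_form (H p)"
    "\<forall>\<^sub>F y in atin X p. \<forall>K. positive_form K \<longrightarrow> pullback (A y) K = K \<longrightarrow> pullback (B y) K = K \<longrightarrow> H y = K"
proof -
  obtain U \<phi> where U: "(U, \<phi>) \<in> \<A>" "p \<in> U"
    and lead: "\<exists>a n. (has_real_power_series ((\<lambda>x. commutator (A x) (B x)) \<circ> inv_into U \<phi>) a (\<phi> p) \<or>
        has_real_power_series ((\<lambda>x. commutator (B x) (A x)) \<circ> inv_into U \<phi>) a (\<phi> p)) \<and>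
      (\<forall>k<n. a k = 0) \<and> rank (a n) = 2"
    using irr unfolding infinitesimally_irreducible_def by blast
  note nhds_iff = chart_eventually_nhds(1)[OF C(1) U]
  define t where "t = \<phi> p"
  let ?i = "inv_into U \<phi>"
  have it: "?i t = p"
    unfolding t_def using chart_eventually_nhds(3)[OF C(1) U] U(2) by simp
  obtain a n where a: "\<forall>k<n. a k = 0" "rank (a n) = 2"
    "has_real_power_series (\<lambda>x. commutator (A (?i x)) (B (?i x))) a t \<or>
     has_real_power_series (\<lambda>x. commutator (B (?i x)) (A (?i x))) a t"
    using lead unfolding t_def o_def by blast
  have "\<exists>g. real_analytic_at g t \<and> det (g t) \<noteq> 0 \<and>
      (\<forall>\<^sub>F x in nhds t. commutator (A (?i x)) (B (?i x)) = (x - t) ^ n *\<^sub>R g x)"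
    using a(3)
  proof
    assume "has_real_power_series (\<lambda>x. commutator (A (?i x)) (B (?i x))) a t"
    from has_real_power_series_shift[OF this a(1)] obtain g where
      "has_real_power_series g (\<lambda>k. a (k + n)) t" "g t = a n"
      "\<forall>\<^sub>F x in nhds t. commutator (A (?i x)) (B (?i x)) = (x - t) ^ n *\<^sub>R g x" .
    then show ?thesis
      using a(2) rank_eq_2_iff_det[of "a n"] unfolding real_analytic_at_def
      by (intro exI[of _ g]) auto
  next
    assume "has_real_power_series (\<lambda>x. commutator (B (?i x)) (A (?i x))) a t"
    from has_real_power_series_shift[OF this a(1)] obtain g where
      g: "has_real_power_series g (\<lambda>k. a (k + n)) t" "g t = a n"
      "\<forall>\<^sub>F x in nhds t. commutator (B (?i x)) (A (?i x)) = (x - t) ^ n *\<^sub>R g x" .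
    have "real_analytic_at (\<lambda>x. - g x) t"
      using g(1) by (intro real_analytic_at_bounded_linear[OF bounded_linear_minus[OF bounded_linear_ident]])
        (auto simp: real_analytic_at_def)
    moreover have "det (- g t) = det (g t)"
      by (simp add: det_2)
    moreover have "\<forall>\<^sub>F x in nhds t. commutator (A (?i x)) (B (?i x)) = (x - t) ^ n *\<^sub>R - g x"
      using g(3) by eventually_elim (subst commutator_swap, simp)
    ultimately show ?thesis
      using a(2) rank_eq_2_iff_det[of "a n"] g(2) by (intro exI[of _ "\<lambda>x. - g x"]) auto
  qed
  then obtain g where g: "real_analytic_at g t" "det (g t) \<noteq> 0"
    "\<forall>\<^sub>F x in nhds t. commutator (A (?i x)) (B (?i x)) = (x - t) ^ n *\<^sub>R g x" by blast
  obtain N V where N: "openin X N" "p \<in> N" "analytic_map_into \<A> N SL2 V"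
    "\<forall>y\<in>N. is_diagonal (V y ** A y ** matrix_inv (V y))"
    using diag unfolding locally_diagonalizable_def by blast
  have V: "analytic_at_point \<A> V p" "\<forall>y\<in>N. V y \<in> SL2"
    using N(2,3) unfolding analytic_map_into_def by auto
  have top: "\<forall>\<^sub>F y in nhdsin X p. y \<in> topspace X"
    unfolding eventually_nhdsin by blast
  have nearN: "\<forall>\<^sub>F y in nhdsin X p. y \<in> N"
    using N(1,2) unfolding eventually_nhdsin by blast
  have "\<forall>\<^sub>F y in nhdsin X p. V y \<in> SL2"
    using nearN by eventually_elim (use V(2) in blast)
  moreover have "\<forall>\<^sub>F y in nhdsin X p. is_diagonal (V y ** A y ** matrix_inv (V y))"
    using nearN by eventually_elim (use N(4) in blast)
  moreover have "\<forall>\<^sub>F y in nhdsin X p. A y \<in> SL2 \<and> B y \<in> SL2"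
    using top by eventually_elim (use SL in blast)
  moreover have
    "\<forall>\<^sub>F y in nhdsin X p. \<exists>K. positive_form K \<and> pullback (A y) K = K \<and> pullback (B y) K = K"
    using top by eventually_elim (use inv in blast)
  ultimately have ev: "\<forall>\<^sub>F x in nhds t. V (?i x) \<in> SL2"
    "\<forall>\<^sub>F x in nhds t. is_diagonal (V (?i x) ** A (?i x) ** matrix_inv (V (?i x)))"
    "\<forall>\<^sub>F x in nhds t. A (?i x) \<in> SL2 \<and> B (?i x) \<in> SL2"
    "\<forall>\<^sub>F x in at t. \<exists>K. positive_form K \<and> pullback (A (?i x)) K = K \<and> pullback (B (?i x)) K = K"
    unfolding nhds_iff t_def by (simp_all add: eventually_nhds_conv_at)
  have "real_analytic_at (\<lambda>x. V (?i x)) t"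
    using V(1) unfolding analytic_at_point_iff[OF C(1) U] o_def t_def .
  from local_invariant_form[OF this ev(1,2,3) g ev(4)] obtain H where
    H: "real_analytic_at H t" "positive_form (H t)"
      "\<forall>\<^sub>F x in at t. \<forall>K. positive_form K \<longrightarrow> pullback (A (?i x)) K = K \<longrightarrow> pullback (B (?i x)) K = K \<longrightarrow> H x = K" .
  have chart_inv: "\<forall>\<^sub>F x in nhds t. \<phi> (?i x) = x"
    using chart_eventually_nhds(2)[OF C(1) U] unfolding t_def
    by eventually_elim (simp add: f_inv_into_f)
  show thesis
  proof (rule that[of "H \<circ> \<phi>"])
    show "analytic_at_point \<A> (H \<circ> \<phi>) p"
      unfolding analytic_at_point_iff[OF C(1) U] t_def[symmetric]
    proof (rule real_analytic_at_cong[THEN iffD2, OF _ H(1)])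
      show "\<forall>\<^sub>F x in nhds t. ((H \<circ> \<phi>) \<circ> ?i) x = H x"
        using chart_inv by eventually_elim simp
    qed
    show "positive_form ((H \<circ> \<phi>) p)" using H(2) by (simp add: t_def)
    have "\<forall>\<^sub>F x in at t. \<phi> (?i x) = x" using chart_inv by (simp add: eventually_nhds_conv_at)
    with H(3) show "\<forall>\<^sub>F y in atin X p. \<forall>K. positive_form K \<longrightarrow> pullback (A y) K = K \<longrightarrow>
        pullback (B y) K = K \<longrightarrow> (H \<circ> \<phi>) y = K"
      unfolding chart_eventually_at[OF C(1) U] t_def[symmetric]
      by eventually_elim simp
  qed
qed

text \<open>Choose a local form \<open>H p\<close> at every point \<open>p\<close> and let \<open>G p = H p p\<close>. By continuity \<open>G p\<close> is
  invariant under all \<open>M k p\<close>. At points \<open>y\<close> near \<open>p\<close> uniqueness gives \<open>G y = H p y\<close>, so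
  the diagonal choice \<open>G\<close> is analytic although it is assembled from unrelated local forms.\<close>

lemma unitarizable_if_local_conditions:
  assumes C: "analytic_curve X \<A>"
    and M: "\<forall>k\<in>{1..q}. analytic_map_into \<A> (topspace X) SL2 (M k)"
    and rs: "r \<in> {1..q}" "s \<in> {1..q}"
    and ne: "\<exists>p\<in>topspace X. commutator (M r p) (M s p) \<noteq> 0"
    and cond: "\<forall>p\<in>topspace X. pointwise_simultaneously_unitarizable q M p \<and>
        (locally_diagonalizable X \<A> (M r) p \<or> locally_diagonalizable X \<A> (M s) p) \<and>
        infinitesimally_irreducible X \<A> (M r) (M s) p"
  shows "globally_simultaneously_unitarizable X \<A> q M"
proof -
  have M_SL: "M k p \<in> SL2" and M_an: "analytic_at_point \<A> (M k) p"
    if "k \<in> {1..q}" "p \<in> topspace X" for k p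
    using M that unfolding analytic_map_into_def by auto
  have form: "\<exists>K. positive_form K \<and> (\<forall>k\<in>{1..q}. pullback (M k y) K = K)"
    if "y \<in> topspace X" for y
    using cond pointwise_unitarizable_iff_form[of q M y] M_SL that by blast
  then have inv: "\<exists>K. positive_form K \<and> pullback (M r y) K = K \<and> pullback (M s y) K = K"
    if "y \<in> topspace X" for y
    using that rs by blast
  have comm_ne: "\<forall>\<^sub>F y in atin X p. commutator (M r y) (M s y) \<noteq> 0" if "p \<in> topspace X" for p
    using that ne M_an rs
    by (intro eventually_nonzero_on_curve[OF C]) (auto intro: analytic_at_point_commutator)
  have "\<exists>H. analytic_at_point \<A> H p \<and> positive_form (H p) \<and> (\<forall>\<^sub>F y in atin X p.
      \<forall>K. positive_form K \<longrightarrow> pullback (M r y) K = K \<longrightarrow> pullback (M s y) K = K \<longrightarrow> H y = K)"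
    if p: "p \<in> topspace X" for p
  proof -
    consider "locally_diagonalizable X \<A> (M r) p" | "locally_diagonalizable X \<A> (M s) p"
      using cond p by blast
    then show ?thesis
    proof cases
      case 1
      obtain H where "analytic_at_point \<A> H p" "positive_form (H p)" "\<forall>\<^sub>F y in atin X p.
          \<forall>K. positive_form K \<longrightarrow> pullback (M r y) K = K \<longrightarrow> pullback (M s y) K = K \<longrightarrow> H y = K"
        by (rule invariant_form_near_point[OF C p _ 1, of "M s"]) (use M_SL rs cond p inv in auto)
      then show ?thesis by blast
    next
      case 2
      obtain H where H: "analytic_at_point \<A> H p" "positive_form (H p)" "\<forall>\<^sub>F y in atin X p.
          \<forall>K. positive_form K \<longrightarrow> pullback (M s y) K = K \<longrightarrow> pullback (M r y) K = K \<longrightarrow> H y = K"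
        by (rule invariant_form_near_point[OF C p _ 2, of "M r"]) (use M_SL rs cond p inv in fast)+
      have "\<forall>\<^sub>F y in atin X p.
          \<forall>K. positive_form K \<longrightarrow> pullback (M r y) K = K \<longrightarrow> pullback (M s y) K = K \<longrightarrow> H y = K"
        using H(3) by eventually_elim blast
      with H show ?thesis by blast
    qed
  qed
  then have "\<forall>p\<in>topspace X. \<exists>H. analytic_at_point \<A> H p \<and> positive_form (H p) \<and> (\<forall>\<^sub>F y in atin X p.
      \<forall>K. positive_form K \<longrightarrow> pullback (M r y) K = K \<longrightarrow> pullback (M s y) K = K \<longrightarrow> H y = K)"
    by blast
  from bchoice[OF this] obtain H where H: "\<And>p. p \<in> topspace X \<Longrightarrow> analytic_at_point \<A> (H p) p"
    "\<And>p. p \<in> topspace X \<Longrightarrow> positive_form (H p p)"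
    "\<And>p. p \<in> topspace X \<Longrightarrow> \<forall>\<^sub>F y in atin X p.
      \<forall>K. positive_form K \<longrightarrow> pullback (M r y) K = K \<longrightarrow> pullback (M s y) K = K \<longrightarrow> H p y = K"
    by blast
  have at_top: "\<forall>\<^sub>F y in atin X p. y \<in> topspace X" if "p \<in> topspace X" for p
    using that unfolding eventually_atin by blast
  define G where "G p = H p p" for p
  have G_inv: "pullback (M k p) (G p) = G p" if k: "k \<in> {1..q}" and p: "p \<in> topspace X" for k p
    unfolding G_def
  proof (rule analytic_at_point_eq[where f = "\<lambda>y. pullback (M k y) (H p y)", OF C p _ H(1)[OF p]])
    show "analytic_at_point \<A> (\<lambda>y. pullback (M k y) (H p y)) p"
      by (intro analytic_at_point_pullback M_an H k p)
    show "\<forall>\<^sub>F y in atin X p. pullback (M k y) (H p y) = H p y"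
      using H(3)[OF p] at_top[OF p]
    proof eventually_elim
      case (elim y)
      obtain K where K: "positive_form K" "\<forall>k\<in>{1..q}. pullback (M k y) K = K"
        using form[OF elim(2)] by blast
      then have "H p y = K" using elim(1) rs by blast
      with K(2) k show ?case by simp
    qed
  qed
  have G_an: "analytic_at_point \<A> G p" if p: "p \<in> topspace X" for p
  proof (rule analytic_at_point_cong[OF C p _ H(1)[OF p]])
    have "\<forall>\<^sub>F y in atin X p. G y = H p y"
      using H(3)[OF p] at_top[OF p]
    proof eventually_elim
      case (elim y)
      have "H p y = G y"
        using elim(1) H(2)[OF elim(2)] G_inv[OF rs(1) elim(2)] G_inv[OF rs(2) elim(2)]
        unfolding G_def by blast
      then show ?case ..
    qed
    then show "\<forall>\<^sub>F y in nhdsin X p. G y = H p y"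
      unfolding eventually_nhdsin_iff_atin[OF p] by (simp add: G_def)
  qed
  have "simultaneous_unitarizer X \<A> q M (\<lambda>p. cholesky (G p))"
    unfolding simultaneous_unitarizer_def analytic_map_into_def
  proof (intro conjI ballI)
    fix p assume p: "p \<in> topspace X"
    have pos: "positive_form (G p)" unfolding G_def by (rule H(2)[OF p])
    show SL: "cholesky (G p) \<in> SL2" by (rule cholesky(1)[OF pos])
    obtain U \<phi> where U: "(U, \<phi>) \<in> \<A>" "p \<in> U" using curve_chart_exists[OF C p] .
    have "inv_into U \<phi> (\<phi> p) = p"
      using chart_eventually_nhds(3)[OF C U] U(2) by simp
    then show "analytic_at_point \<A> (\<lambda>p. cholesky (G p)) p"
      using G_an[OF p] pos unfolding analytic_at_point_iff[OF C U] o_def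
      by (intro real_analytic_at_cholesky) simp_all
  next
    fix k p assume k: "k \<in> {1..q}" and p: "p \<in> topspace X"
    have pos: "positive_form (G p)" unfolding G_def by (rule H(2)[OF p])
    show "cholesky (G p) ** M k p ** matrix_inv (cholesky (G p)) \<in> SU2"
      unfolding conjugate_in_SU2_iff[OF cholesky(1)[OF pos] M_SL[OF k p]] cholesky(2)[OF pos]
      by (rule G_inv[OF k p])
  qed
  then show ?thesis
    unfolding globally_simultaneously_unitarizable_def by blast
qed

section \<open>Consequences of a global unitarizer\<close>

text \<open>After conjugation by the unitarizer the commutator, and with it its leading coefficient, is
  quaternionic; nonzero quaternions are invertible.\<close>

lemma unitarizer_imp_infinitesimally_irreducible:
  assumes C: "analytic_curve X \<A>" "p \<in> topspace X"
    and M: "\<forall>y\<in>topspace X. analytic_at_point \<A> A y \<and> analytic_at_point \<A> B y"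
    and V: "analytic_map_into \<A> (topspace X) SL2 V"
      "\<forall>y\<in>topspace X. V y ** A y ** matrix_inv (V y) \<in> SU2 \<and> V y ** B y ** matrix_inv (V y) \<in> SU2"
    and ne: "\<exists>y\<in>topspace X. commutator (A y) (B y) \<noteq> 0"
  shows "infinitesimally_irreducible X \<A> A B p"
proof -
  obtain U \<phi> where U: "(U, \<phi>) \<in> \<A>" "p \<in> U" using curve_chart_exists[OF C] .
  let ?i = "inv_into U \<phi>"
  define t where "t = \<phi> p"
  define c where "c = (\<lambda>y. commutator (A y) (B y)) \<circ> ?i"
  define v where "v = V \<circ> ?i"
  have c_an: "real_analytic_at c t"
    unfolding c_def t_def analytic_at_point_iff[OF C(1) U, symmetric]
    using M C(2) by (intro analytic_at_point_commutator) auto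
  have v_an: "real_analytic_at v t"
    unfolding v_def t_def analytic_at_point_iff[OF C(1) U, symmetric]
    using V(1) C(2) by (simp add: analytic_map_into_def)
  have top: "\<forall>\<^sub>F y in nhdsin X p. y \<in> topspace X"
    unfolding eventually_nhdsin by blast
  then have top': "\<forall>\<^sub>F x in nhds t. ?i x \<in> topspace X"
    unfolding chart_eventually_nhds(1)[OF C(1) U] t_def .
  have v_SL: "\<forall>\<^sub>F x in nhds t. v x \<in> SL2"
    using top' by eventually_elim (use V(1) in \<open>simp add: analytic_map_into_def v_def\<close>)
  have "\<forall>\<^sub>F y in atin X p. commutator (A y) (B y) \<noteq> 0"
    using ne M by (intro eventually_nonzero_on_curve[OF C(1) _ _ C(2)])
      (auto intro: analytic_at_point_commutator)
  then have "\<forall>\<^sub>F x in at t. c x \<noteq> 0"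
    unfolding chart_eventually_at[OF C(1) U] t_def c_def by simp
  then have "\<not> (\<forall>\<^sub>F x in at t. c x = 0)"
    using eventually_conj[of "\<lambda>x. c x \<noteq> 0" "at t" "\<lambda>x. c x = 0"] by auto
  then have "\<not> (\<forall>\<^sub>F x in nhds t. c x = 0)"
    by (auto simp: eventually_nhds_conv_at)
  then obtain n g where g: "real_analytic_at g t" "g t \<noteq> 0"
    "\<forall>\<^sub>F x in nhds t. c x = (x - t) ^ n *\<^sub>R g x"
    using real_analytic_at_leading_term[OF c_an] by blast
  define g1 where "g1 x = v x ** g x ** matrix_inv (v x)" for x
  have g1_an: "real_analytic_at g1 t"
    unfolding g1_def by (intro real_analytic_at_matrix_mult real_analytic_at_matrix_inv v_an v_SL g)
  have "\<forall>\<^sub>F x in nhds t. quaternionic ((x - t) ^ n *\<^sub>R g1 x)"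
    using top' g(3) v_SL
  proof eventually_elim
    case (elim x)
    have "quaternionic (commutator (v x ** A (?i x) ** matrix_inv (v x))
        (v x ** B (?i x) ** matrix_inv (v x)))"
      using V(2) elim(1) by (intro quaternionic_commutator) (simp_all add: SU2_iff v_def)
    also have "commutator (v x ** A (?i x) ** matrix_inv (v x)) (v x ** B (?i x) ** matrix_inv (v x)) =
        v x ** c x ** matrix_inv (v x)"
      by (simp add: commutator_conjugate[OF elim(3)] c_def)
    also have "\<dots> = (x - t) ^ n *\<^sub>R g1 x"
      unfolding elim(2) g1_def by (rule conjugate_scaleR)
    finally show ?case .
  qed
  then have "\<forall>\<^sub>F x in nhds t. quaternionic (g1 x)"
    by (intro quaternionic_leading_coefficient[OF g1_an, where n = n])
      (simp add: eventually_nhds_conv_at)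
  then have "quaternionic (g1 t)" by (rule eventually_nhds_x_imp_x)
  moreover have v_t: "v t \<in> SL2" using v_SL by (rule eventually_nhds_x_imp_x)
  moreover have "g1 t \<noteq> 0"
    unfolding g1_def using conjugate_eq_0_iff[OF v_t] g(2) by blast
  ultimately have "det (g t) \<noteq> 0"
    using quaternionic_det_eq_0_iff[of "g1 t"] det_conjugate[OF v_t, of "g t"] by (simp add: g1_def)
  obtain b where b: "has_real_power_series g b t"
    using g(1) unfolding real_analytic_at_def by blast
  define a where "a = (\<lambda>k. if k < n then 0 else b (k - n))"
  have "has_real_power_series c a t"
    unfolding a_def by (rule has_real_power_series_unshift[OF b g(3)])
  moreover have "a n = g t"
    using has_real_power_series_at_center[OF b] by (simp add: a_def)
  moreover have "\<forall>k<n. a k = 0" by (simp add: a_def)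
  ultimately have "\<exists>a n. has_real_power_series c a t \<and> (\<forall>k<n. a k = 0) \<and> a n \<noteq> 0 \<and> rank (a n) = 2"
    using \<open>det (g t) \<noteq> 0\<close> g(2) rank_eq_2_iff_det[of "g t"] by (intro exI[of _ a] exI[of _ n]) simp
  then show ?thesis
    unfolding infinitesimally_irreducible_def using ne U c_def t_def by blast
qed

lemma unitarizer_imp_locally_diagonalizable:
  assumes C: "analytic_curve X \<A>" "p \<in> topspace X"
    and M: "analytic_at_point \<A> A p"
    and V: "analytic_map_into \<A> (topspace X) SL2 V"
      "\<forall>y\<in>topspace X. V y ** A y ** matrix_inv (V y) \<in> SU2"
  shows "locally_diagonalizable X \<A> A p"
proof -
  obtain U \<phi> where U: "(U, \<phi>) \<in> \<A>" "p \<in> U" using curve_chart_exists[OF C] .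
  let ?i = "inv_into U \<phi>"
  define t where "t = \<phi> p"
  define v where "v = V \<circ> ?i"
  define S where "S x = v x ** (A \<circ> ?i) x ** matrix_inv (v x)" for x
  have V_an: "analytic_at_point \<A> V p"
    using V(1) C(2) by (simp add: analytic_map_into_def)
  then have v_an: "real_analytic_at v t"
    unfolding v_def t_def analytic_at_point_iff[OF C(1) U] .
  have a_an: "real_analytic_at (A \<circ> ?i) t"
    using M unfolding t_def analytic_at_point_iff[OF C(1) U] .
  have top: "\<forall>\<^sub>F y in nhdsin X p. y \<in> topspace X"
    unfolding eventually_nhdsin by blast
  then have top': "\<forall>\<^sub>F x in nhds t. ?i x \<in> topspace X"
    unfolding chart_eventually_nhds(1)[OF C(1) U] t_def .
  have v_SL: "\<forall>\<^sub>F x in nhds t. v x \<in> SL2"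
    using top' by eventually_elim (use V(1) in \<open>simp add: analytic_map_into_def v_def\<close>)
  have "real_analytic_at S t"
    unfolding S_def by (intro real_analytic_at_matrix_mult real_analytic_at_matrix_inv v_an v_SL a_an)
  moreover have "\<forall>\<^sub>F x in nhds t. quaternionic (S x)"
    using top' by eventually_elim (use V(2) in \<open>simp add: S_def v_def SU2_iff\<close>)
  ultimately obtain Q where Q: "real_analytic_at Q t" "\<forall>\<^sub>F x in nhds t. Q x \<in> SL2"
    "\<forall>\<^sub>F x in nhds t. is_diagonal (Q x ** S x ** matrix_inv (Q x))"
    by (rule quaternionic_locally_diagonalizable)
  define W where "W y = Q (\<phi> y) ** V y" for y
  have chart_inv: "\<forall>\<^sub>F x in nhds t. \<phi> (?i x) = x"
    using chart_eventually_nhds(2)[OF C(1) U] unfolding t_def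
    by eventually_elim (simp add: f_inv_into_f)
  have "analytic_at_point \<A> W p"
    unfolding analytic_at_point_iff[OF C(1) U] t_def[symmetric]
  proof (rule real_analytic_at_cong[THEN iffD2])
    show "\<forall>\<^sub>F x in nhds t. (W \<circ> ?i) x = Q x ** v x"
      using chart_inv by eventually_elim (simp add: W_def v_def)
    show "real_analytic_at (\<lambda>x. Q x ** v x) t"
      by (rule real_analytic_at_matrix_mult[OF Q(1) v_an])
  qed
  then have "\<forall>\<^sub>F y in nhdsin X p. analytic_at_point \<A> W y"
    by (rule eventually_analytic_at_point[OF C])
  moreover have "\<forall>\<^sub>F y in nhdsin X p. W y \<in> SL2 \<and> is_diagonal (W y ** A y ** matrix_inv (W y))"
    unfolding chart_eventually_nhds(1)[OF C(1) U] t_def[symmetric]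
    using Q(2,3) v_SL chart_inv
  proof eventually_elim
    case (elim x)
    then have "W (?i x) = Q x ** v x" by (simp add: W_def v_def)
    then show ?case
      using elim SL2_mult conjugate_conjugate[OF elim(3,1), of "A (?i x)"] by (simp add: S_def)
  qed
  ultimately have "\<forall>\<^sub>F y in nhdsin X p. analytic_at_point \<A> W y \<and> W y \<in> SL2 \<and>
      is_diagonal (W y ** A y ** matrix_inv (W y))"
    by eventually_elim blast
  then obtain N where "openin X N" "p \<in> N" "\<forall>y\<in>N. analytic_at_point \<A> W y \<and> W y \<in> SL2 \<and>
      is_diagonal (W y ** A y ** matrix_inv (W y))"
    using C(2) unfolding eventually_nhdsin by blast
  then show ?thesis
    unfolding locally_diagonalizable_def analytic_map_into_def by blast
qed

text \<open>Two unitarizers induce the same invariant form off the isolated zeros of the commutator, hence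
  everywhere, and the quotient of two factors of one form is unitary.\<close>

lemma unitarizer_unique:
  assumes C: "analytic_curve X \<A>"
    and M: "\<forall>k\<in>{1..q}. analytic_map_into \<A> (topspace X) SL2 (M k)"
    and rs: "r \<in> {1..q}" "s \<in> {1..q}"
    and ne: "\<exists>p\<in>topspace X. commutator (M r p) (M s p) \<noteq> 0"
    and V: "simultaneous_unitarizer X \<A> q M V" and W: "simultaneous_unitarizer X \<A> q M W"
  shows "\<exists>U. analytic_map_into \<A> (topspace X) SU2 U \<and> (\<forall>p\<in>topspace X. W p = U p ** V p)"
proof -
  have M_SL: "M k p \<in> SL2" and M_an: "analytic_at_point \<A> (M k) p"
    if "k \<in> {1..q}" "p \<in> topspace X" for k p
    using M that unfolding analytic_map_into_def by auto
  have V_SL: "V p \<in> SL2" "W p \<in> SL2" and V_an: "analytic_at_point \<A> V p" "analytic_at_point \<A> W p"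
    if "p \<in> topspace X" for p
    using V W that unfolding simultaneous_unitarizer_def analytic_map_into_def by auto
  have form: "pullback (M k p) (pullback (V p) (mat 1)) = pullback (V p) (mat 1)"
    "pullback (M k p) (pullback (W p) (mat 1)) = pullback (W p) (mat 1)"
    if "k \<in> {1..q}" "p \<in> topspace X" for k p
    using V W conjugate_in_SU2_iff[OF V_SL(1) M_SL] conjugate_in_SU2_iff[OF V_SL(2) M_SL] that
    unfolding simultaneous_unitarizer_def by blast+
  have same: "pullback (V p) (mat 1) = pullback (W p) (mat 1)" if p: "p \<in> topspace X" for p
  proof (rule analytic_at_point_eq[OF C p])
    have one: "analytic_at_point \<A> (\<lambda>y. mat 1 :: complex^2^2) p"
      unfolding analytic_at_point_def
      by (auto simp: o_def mat_def intro!: real_analytic_at_matrixI real_analytic_at_const)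
    show "analytic_at_point \<A> (\<lambda>p. pullback (V p) (mat 1)) p"
      "analytic_at_point \<A> (\<lambda>p. pullback (W p) (mat 1)) p"
      by (rule analytic_at_point_pullback[OF V_an(1)[OF p] one]
          analytic_at_point_pullback[OF V_an(2)[OF p] one])+
    have "\<forall>\<^sub>F y in atin X p. commutator (M r y) (M s y) \<noteq> 0"
      using p ne M_an rs
      by (intro eventually_nonzero_on_curve[OF C]) (auto intro: analytic_at_point_commutator)
    moreover have "\<forall>\<^sub>F y in atin X p. y \<in> topspace X"
      using p unfolding eventually_atin by blast
    ultimately show "\<forall>\<^sub>F y in atin X p. pullback (V y) (mat 1) = pullback (W y) (mat 1)"
    proof eventually_elim
      case (elim y)
      show ?case
        by (rule invariant_form_unique[of _ "M r y" "M s y"])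
          (use elim form rs V_SL M_SL positive_form_pullback positive_form_mat_1 in auto)
    qed
  qed
  define U where "U p = W p ** matrix_inv (V p)" for p
  have "U p \<in> SU2" if p: "p \<in> topspace X" for p
  proof -
    have "U p \<in> SL2" unfolding U_def by (intro SL2_mult SL2_inverse V_SL p)
    moreover have "pullback (U p) (mat 1) = mat 1"
      unfolding U_def pullback_mult same[OF p, symmetric] by (rule pullback_inverse(2)[OF V_SL(1)[OF p]])
    ultimately show ?thesis by (simp add: unitary_iff_pullback)
  qed
  moreover have "analytic_at_point \<A> U p" if p: "p \<in> topspace X" for p
    unfolding U_def
  proof (rule analytic_at_point_matrix_mult[OF V_an(2)[OF p]])
    obtain N \<phi> where N: "(N, \<phi>) \<in> \<A>" "p \<in> N" using curve_chart_exists[OF C p] .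
    have "\<forall>\<^sub>F y in nhdsin X p. V y \<in> SL2"
      unfolding eventually_nhdsin using V_SL(1) p by blast
    then show "analytic_at_point \<A> (\<lambda>p. matrix_inv (V p)) p"
      using V_an(1)[OF p] unfolding analytic_at_point_iff[OF C N] chart_eventually_nhds(1)[OF C N] o_def
      by (intro real_analytic_at_matrix_inv)
  qed
  moreover have "W p = U p ** V p" if p: "p \<in> topspace X" for p
    unfolding U_def by (simp add: SL2_cancel V_SL(1)[OF p])
  ultimately show ?thesis
    unfolding analytic_map_into_def by blast
qed

section \<open>Global simultaneous unitarizability\<close>

theorem theorem3p4:
  fixes X :: "'a topology" and \<A> :: "'a chart set"
    and q r s :: nat and M :: "nat \<Rightarrow> 'a \<Rightarrow> complex^2^2"
  assumes "analytic_curve X \<A>"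
    and "q \<ge> 2"
    and "\<forall>k \<in> {1..q}. analytic_map_into \<A> (topspace X) SL2 (M k)"
    and "r \<in> {1..q}" and "s \<in> {1..q}"
    and "\<exists>p \<in> topspace X. commutator (M r p) (M s p) \<noteq> 0"
  shows "(globally_simultaneously_unitarizable X \<A> q M \<longleftrightarrow>
      (\<forall>p \<in> topspace X.
        pointwise_simultaneously_unitarizable q M p \<and>
        (locally_diagonalizable X \<A> (M r) p \<or> locally_diagonalizable X \<A> (M s) p) \<and>
        infinitesimally_irreducible X \<A> (M r) (M s) p))
    \<and> (\<forall>V W. simultaneous_unitarizer X \<A> q M V \<and> simultaneous_unitarizer X \<A> q M W \<longrightarrow>
        (\<exists>U. analytic_map_into \<A> (topspace X) SU2 U \<and> (\<forall>p \<in> topspace X. W p = U p ** V p)))"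
proof (intro conjI iffI allI impI ballI)
  fix p assume "globally_simultaneously_unitarizable X \<A> q M" and p: "p \<in> topspace X"
  then obtain V where V: "analytic_map_into \<A> (topspace X) SL2 V"
    "\<forall>k\<in>{1..q}. \<forall>p\<in>topspace X. V p ** M k p ** matrix_inv (V p) \<in> SU2"
    unfolding globally_simultaneously_unitarizable_def simultaneous_unitarizer_def by blast
  have M_an: "\<forall>y\<in>topspace X. analytic_at_point \<A> (M r) y \<and> analytic_at_point \<A> (M s) y"
    using assms(3-5) unfolding analytic_map_into_def by blast
  show "pointwise_simultaneously_unitarizable q M p"
    using V p unfolding pointwise_simultaneously_unitarizable_def analytic_map_into_def by blast
  show "locally_diagonalizable X \<A> (M r) p \<or> locally_diagonalizable X \<A> (M s) p"
    using unitarizer_imp_locally_diagonalizable[OF assms(1) p _ V(1)] M_an V(2) assms(4) p by blast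
  show "infinitesimally_irreducible X \<A> (M r) (M s) p"
    using V(2) assms(4,5)
    by (intro unitarizer_imp_infinitesimally_irreducible[OF assms(1) p M_an V(1) _ assms(6)]) blast
next
  assume "\<forall>p \<in> topspace X.
        pointwise_simultaneously_unitarizable q M p \<and>
        (locally_diagonalizable X \<A> (M r) p \<or> locally_diagonalizable X \<A> (M s) p) \<and>
        infinitesimally_irreducible X \<A> (M r) (M s) p"
  then show "globally_simultaneously_unitarizable X \<A> q M"
    by (rule unitarizable_if_local_conditions[OF assms(1,3,4,5,6)])
next
  fix V W assume "simultaneous_unitarizer X \<A> q M V \<and> simultaneous_unitarizer X \<A> q M W"
  then show "\<exists>U. analytic_map_into \<A> (topspace X) SU2 U \<and> (\<forall>p \<in> topspace X. W p = U p ** V p)"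
    using unitarizer_unique[OF assms(1,3,4,5,6)] by blast
qed

end
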